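(* Let $\alpha,\beta>-1$. Assume that for some family of pairs $(f,g)$ of nonnegative functions on $(0,\pi)$, for some fixed $1<r<\infty$, and for all $w\in A_r^{\alpha,\beta}$, we have $$\int_0^\pi g(\theta)^r\,w(\theta)\,d\mu_{\alpha,\beta}(\theta)\le C\int_0^\pi f(\theta)^r\,w(\theta)\,d\mu_{\alpha,\beta}(\theta)$$ for all pairs $(f,g)$ of the family, with $C$ not depending on the pair $(f,g)$ (it may depend on $w$). Then, for all $1<p<\infty$ and all $w\in A_p^{\alpha,\beta}$, we have $$\int_0^\pi g(\theta)^p\,w(\theta)\,d\mu_{\alpha,\beta}(\theta)\le C\int_0^\pi f(\theta)^p\,w(\theta)\,d\mu_{\alpha,\beta}(\theta)$$ for all pairs $(f,g)$ of the family, with $C$ not depending on the pair $(f,g)$.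
   Context: $d\mu_{\alpha,\beta}(\theta)=(\sin\frac\theta2)^{2\alpha+1}(\cos\frac\theta2)^{2\beta+1}d\theta$ on $(0,\pi)$. For $1<p<\infty$, $p'=p/(p-1)$, $A_p^{\alpha,\beta}$ is the class of nonnegative functions $w\in L^1_{\mathrm{loc}}(d\mu_{\alpha,\beta})$ with $w^{-p'/p}\in L^1_{\mathrm{loc}}(d\mu_{\alpha,\beta})$ and $$\sup_{I\subset(0,\pi)}\Big(\frac1{\mu_{\alpha,\beta}(I)}\int_Iw\,d\mu_{\alpha,\beta}\Big)\Big(\frac1{\mu_{\alpha,\beta}(I)}\int_Iw^{-p'/p}\,d\mu_{\alpha,\beta}\Big)^{p/p'}<\infty,$$ the supremum being over intervals $I\subset(0,\pi)$. (These are the $A_p$ weights on the space of homogeneous type $((0,\pi),d\mu_{\alpha,\beta},|\cdot|)$.) *)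

theory Defs
  imports "HOL-Analysis.Analysis"
begin

(* Nonnegative functions are taken with values in ennreal = [0, \<infinity>]; values outside (0, pi) play
   no role.  Real powers on [0, \<infinity>] follow the measure-theoretic conventions
   0 ^ s = \<infinity> and \<infinity> ^ s = 0 for s < 0 (the library's powr has 0 powr s = 0, which would make
   w ^ (- p' / p) vanish, instead of blow up, where w = 0). *)

definition epowr :: "ennreal \<Rightarrow> real \<Rightarrow> ennreal" where
  "epowr x s =
     (if s = 0 then 1
      else if x = 0 then (if s > 0 then 0 else \<infinity>)
      else if x = \<infinity> then (if s > 0 then \<infinity> else 0)
      else ennreal (enn2real x powr s))"

lemma epowr_ennreal: "0 < x \<Longrightarrow> epowr (ennreal x) s = ennreal (x powr s)"
  by (auto simp: epowr_def)

definition jacobi_measure :: "real \<Rightarrow> real \<Rightarrow> real measure" where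
  "jacobi_measure \<alpha> \<beta> =
     density (lebesgue_on {0<..<pi})
       (\<lambda>\<theta>. ennreal (sin (\<theta> / 2) powr (2 * \<alpha> + 1) * cos (\<theta> / 2) powr (2 * \<beta> + 1)))"

definition conj_exp :: "real \<Rightarrow> real" where
  "conj_exp p = p / (p - 1)"

definition L1_loc :: "real \<Rightarrow> real \<Rightarrow> (real \<Rightarrow> ennreal) set" where
  "L1_loc \<alpha> \<beta> =
     {u \<in> borel_measurable (jacobi_measure \<alpha> \<beta>).
        \<forall>K. compact K \<and> K \<subseteq> {0<..<pi} \<longrightarrow> (\<integral>\<^sup>+\<theta>\<in>K. u \<theta> \<partial>jacobi_measure \<alpha> \<beta>) < \<infinity>}"

definition average :: "real \<Rightarrow> real \<Rightarrow> real set \<Rightarrow> (real \<Rightarrow> ennreal) \<Rightarrow> ennreal" where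
  "average \<alpha> \<beta> I u =
     (\<integral>\<^sup>+\<theta>\<in>I. u \<theta> \<partial>jacobi_measure \<alpha> \<beta>) / emeasure (jacobi_measure \<alpha> \<beta>) I"

(* The requirement interior I \<noteq> {} excludes only the empty and one-point intervals, which are null sets.
   For w in the class, local integrability of w and w ^ (- p' / p) forces 0 < w < \<infinity> a.e., so both
   averages are nonzero and the ennreal convention 0 * \<infinity> = 0 is never used in the supremum. *)

definition A_weights :: "real \<Rightarrow> real \<Rightarrow> real \<Rightarrow> (real \<Rightarrow> ennreal) set" where
  "A_weights \<alpha> \<beta> p =
     {w. w \<in> L1_loc \<alpha> \<beta> \<and>
         (\<lambda>\<theta>. epowr (w \<theta>) (- conj_exp p / p)) \<in> L1_loc \<alpha> \<beta> \<and>
         (SUP I \<in> {I. is_interval I \<and> I \<subseteq> {0<..<pi} \<and> interior I \<noteq> {}}.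
            average \<alpha> \<beta> I w *
            epowr (average \<alpha> \<beta> I (\<lambda>\<theta>. epowr (w \<theta>) (- conj_exp p / p))) (p / conj_exp p)) < \<infinity>}"

(* One finite constant C serves all pairs (f, g) of the family F. *)

definition weighted_bound ::
  "real \<Rightarrow> real \<Rightarrow> ((real \<Rightarrow> ennreal) \<times> (real \<Rightarrow> ennreal)) set \<Rightarrow> real \<Rightarrow> (real \<Rightarrow> ennreal) \<Rightarrow> bool" where
  "weighted_bound \<alpha> \<beta> F p w \<longleftrightarrow>
     (\<exists>C::real. 0 < C \<and> (\<forall>(f, g)\<in>F.
        (\<integral>\<^sup>+\<theta>. epowr (g \<theta>) p * w \<theta> \<partial>jacobi_measure \<alpha> \<beta>)
          \<le> ennreal C * (\<integral>\<^sup>+\<theta>. epowr (f \<theta>) p * w \<theta> \<partial>jacobi_measure \<alpha> \<beta>)))"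

end

theory Submission
  imports Defs
begin

text \<open>The proof is Rubio de Francia's algorithm.  In one dimension the uncentred maximal operator over
  intervals is bounded on \<open>L\<^sup>p(\<nu>)\<close> for every finite measure \<open>\<nu>\<close>, because any finite family of intervals
  has a subfamily with the same union and overlap at most two.  Lerner's pointwise inequality reduces
  the weighted bound of the maximal operator, for a weight in \<open>A\<^sub>p\<close>, to the intrinsic maximal operators
  of the weight and of its dual, so neither doubling nor a reverse Hoelder inequality is needed.
  Geometric series of iterated maximal functions then majorize functions in \<open>L\<^sup>p(w)\<close> and
  \<open>L\<^bsup>p'\<^esup>(w\<^bsup>1-p'\<^esup>)\<close> by \<open>A\<^sub>1\<close> weights \<open>H\<^sub>1\<close> and \<open>H\<^sub>2\<close>, and the hypothesis is applied to the single
  weight \<open>H\<^sub>2 H\<^sub>1\<^bsup>1-r\<^esup>\<close>, which lies in \<open>A\<^sub>r\<close>.\<close>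

subsection \<open>Powers of extended nonnegative reals\<close>

text \<open>The constant in the hypothesis may depend on the weight in any way. Run pair by pair,
  the algorithm would give one weight, hence one constant, for each pair and no control over all of
  them; so majorants are built for whole sequences of normalized functions. Testing g by duality
  against functions v in the dual space lets both majorants enter symmetrically:
  \<open>H\<^sub>1\<close> dominates f up to a factor, \<open>H\<^sub>2\<close> dominates v, and the
  weight W built from them satisfies \<open>H\<^sub>1\<close>^r W = \<open>H\<^sub>1\<close>
  \<open>H\<^sub>2\<close>, an integrable function by Young's inequality. The same argument
  therefore covers p < r and p > r. Finiteness shapes the setting: \<alpha>, \<beta> > -1 makes the
  measure finite, and (0, pi) itself is one of the intervals of the A_p supremum, so a weight and
  its dual are integrable up to the end points. Constants then lie in L^p(w), and the measures with
  densities w and w^(1-p') are finite, as the unweighted maximal theorem requires.\<close>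

lemma epowr_real: "0 < s \<Longrightarrow> 0 \<le> x \<Longrightarrow> epowr (ennreal x) s = ennreal (x powr s)"
  by (auto simp: epowr_def)

lemma epowr_top [simp]: "0 < s \<Longrightarrow> epowr top s = top"
  by (simp add: epowr_def)

lemma epowr_eq_0_iff [simp]: "0 < s \<Longrightarrow> epowr x s = 0 \<longleftrightarrow> x = 0"
  by (cases x) (auto simp: epowr_real ennreal_eq_0_iff)

lemma epowr_eq_top_iff [simp]: "0 < s \<Longrightarrow> epowr x s = top \<longleftrightarrow> x = top"
  by (cases x) (auto simp: epowr_real)

lemma epowr_1 [simp]: "epowr x 1 = x"
  by (cases x) (auto simp: epowr_real)

lemma epowr_mono: "0 < s \<Longrightarrow> x \<le> y \<Longrightarrow> epowr x s \<le> epowr y s"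
  by (cases x; cases y) (auto simp: epowr_real top_unique intro!: ennreal_leI powr_mono2)

lemma epowr_mult: "0 < s \<Longrightarrow> epowr (x * y) s = epowr x s * epowr y s"
  by (cases x; cases y) (auto simp: epowr_real ennreal_mult_top ennreal_top_mult powr_mult
      simp flip: ennreal_mult)

lemma epowr_add: "0 < s \<Longrightarrow> 0 < t \<Longrightarrow> epowr x (s + t) = epowr x s * epowr x t"
  by (cases x) (auto simp: epowr_real powr_add simp flip: ennreal_mult)

text \<open>A negative power exchanges 0 and infinity, so under the conventions of
  \<open>epowr\<close> the law survives for exponents of either sign.\<close>

lemma epowr_epowr: "s \<noteq> 0 \<Longrightarrow> t \<noteq> 0 \<Longrightarrow> epowr (epowr x s) t = epowr x (s * t)"
  by (cases x)
     (auto simp: epowr_def powr_powr mult_pos_pos mult_neg_neg zero_less_mult_iff mult_less_0_iff)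

lemma epowr_measurable [measurable]:
  assumes [measurable]: "f \<in> borel_measurable M"
  shows "(\<lambda>x. epowr (f x) s) \<in> borel_measurable M"
  unfolding epowr_def by measurable

text \<open>The inner integral of the layer cake formula; y may be infinite because maximal
  functions may be.\<close>

lemma nn_integral_powr_below:
  fixes y :: ennreal
  assumes "0 < s"
  shows "(\<integral>\<^sup>+t. ennreal (t powr (s - 1)) * indicator {t. 0 < t \<and> ennreal t < y} t \<partial>lborel)
    = epowr y s * ennreal (1 / s)"
proof -
  have real_case: "(\<integral>\<^sup>+t. ennreal (t powr (s - 1)) * indicator {t. 0 < t \<and> ennreal t < ennreal c} t \<partial>lborel)
    = ennreal (c powr s * (1 / s))" if "0 \<le> c" for c
  proof -
    have "((\<lambda>t. t powr (s - 1)) has_integral c powr (s - 1 + 1) / (s - 1 + 1)) {0..c}"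
      by (rule has_integral_powr_from_0) (use assms that in auto)
    then have "(\<integral>\<^sup>+t. ennreal (t powr (s - 1)) * indicator {0..c} t \<partial>lborel) = ennreal (c powr s / s)"
      by (intro nn_integral_has_integral_lebesgue') auto
    moreover have "(\<integral>\<^sup>+t. ennreal (t powr (s - 1)) * indicator {t. 0 < t \<and> ennreal t < ennreal c} t \<partial>lborel)
       = (\<integral>\<^sup>+t. ennreal (t powr (s - 1)) * indicator {0..c} t \<partial>lborel)"
    proof (rule nn_integral_cong_AE)
      have "AE t in lborel. t \<noteq> (0::real)" "AE t in lborel. t \<noteq> c"
        by (rule AE_lborel_singleton)+
      then show "AE t in lborel. ennreal (t powr (s - 1)) * indicator {t. 0 < t \<and> ennreal t < ennreal c} t
         = ennreal (t powr (s - 1)) * indicator {0..c} t"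
        by eventually_elim (auto simp: indicator_def ennreal_less_iff)
    qed
    ultimately show ?thesis by simp
  qed
  show ?thesis
  proof (cases y)
    case (real c)
    then show ?thesis
      using real_case[of c] assms by (simp add: epowr_real flip: ennreal_mult)
  next
    case top
    let ?I = "\<lambda>y. \<integral>\<^sup>+t. ennreal (t powr (s - 1)) * indicator {t. 0 < t \<and> ennreal t < y} t \<partial>lborel"
    have "ennreal b \<le> ?I top" if "0 \<le> b" for b :: real
    proof -
      \<comment> \<open>The end point \<open>(b * s) powr (1 / s)\<close> is chosen so that the
        integral up to it is exactly b; hence the full integral exceeds every real number.\<close>
      have "ennreal b = ?I (ennreal ((b * s) powr (1 / s)))"
        using that assms by (subst real_case) (auto simp: powr_powr)
      also have "\<dots> \<le> ?I top"
        by (intro nn_integral_mono) (auto simp: indicator_def)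
      finally show ?thesis .
    qed
    from this[of "enn2real (?I top) + 1"] have "?I top = top"
      by (cases "?I top") auto
    then show ?thesis using top assms by (simp add: ennreal_top_mult)
  qed
qed

subsection \<open>The maximal operator of a measure on the line\<close>

text \<open>Only open intervals, so that Lindelof's theorem applies to arbitrary unions of them.
  Under the Jacobi measure end points are null, so averages over other intervals are the
  same.\<close>

definition intervals_of :: "real measure \<Rightarrow> real set set" where
  "intervals_of \<nu> = {I. I \<subseteq> space \<nu> \<and> (\<exists>a b. a < b \<and> I = {a<..<b})}"

definition maximal :: "real measure \<Rightarrow> (real \<Rightarrow> ennreal) \<Rightarrow> real \<Rightarrow> ennreal" where
  "maximal \<nu> f x = (SUP I \<in> {I \<in> intervals_of \<nu>. x \<in> I}. (\<integral>\<^sup>+y\<in>I. f y \<partial>\<nu>) / emeasure \<nu> I)"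

lemma intervals_of_density [simp]: "intervals_of (density \<nu> w) = intervals_of \<nu>"
  by (simp add: intervals_of_def)

lemma open_interval: "I \<in> intervals_of \<nu> \<Longrightarrow> open I"
  by (auto simp: intervals_of_def)

lemma average_le_maximal:
  "I \<in> intervals_of \<nu> \<Longrightarrow> x \<in> I \<Longrightarrow> (\<integral>\<^sup>+y\<in>I. f y \<partial>\<nu>) / emeasure \<nu> I \<le> maximal \<nu> f x"
  unfolding maximal_def by (intro SUP_upper) auto

lemma maximal_superlevel:
  "{x \<in> space \<nu>. t < maximal \<nu> f x} =
    \<Union>{I \<in> intervals_of \<nu>. t < (\<integral>\<^sup>+y\<in>I. f y \<partial>\<nu>) / emeasure \<nu> I}"
  by (auto simp: maximal_def less_SUP_iff intervals_of_def)

lemma countable_interval_cover: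
  assumes "F \<subseteq> intervals_of \<nu>"
  obtains F' where "F' \<subseteq> F" "countable F'" "\<Union>F' = \<Union>F"
  using Lindelof[of F] assms open_interval by (metis subsetD)

text \<open>A superlevel set is a union of possibly uncountably many open intervals; Lindelof
  reduces it to a countable one.\<close>

lemma maximal_measurable:
  assumes "intervals_of \<nu> \<subseteq> sets \<nu>"
  shows "maximal \<nu> f \<in> borel_measurable \<nu>"
proof (rule borel_measurableI_greater)
  fix t
  obtain F' where F': "F' \<subseteq> {I \<in> intervals_of \<nu>. t < (\<integral>\<^sup>+y\<in>I. f y \<partial>\<nu>) / emeasure \<nu> I}"
    "countable F'" "\<Union>F' = \<Union>{I \<in> intervals_of \<nu>. t < (\<integral>\<^sup>+y\<in>I. f y \<partial>\<nu>) / emeasure \<nu> I}"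
    by (rule countable_interval_cover[of "{I \<in> intervals_of \<nu>. t < (\<integral>\<^sup>+y\<in>I. f y \<partial>\<nu>) / emeasure \<nu> I}"]) auto
  have "\<Union>F' \<in> sets \<nu>"
    using F' assms by (intro sets.countable_Union) auto
  then show "{x \<in> space \<nu>. t < maximal \<nu> f x} \<in> sets \<nu>"
    unfolding maximal_superlevel F'(3) .
qed

section \<open>Covering by intervals and the weak type inequality\<close>

text \<open>G is a subfamily of least cardinality with the same union. Among the members through x,
  let P reach furthest left and Q furthest right. Both contain x, so they cover every other member
  through x; a third one could be dropped, against minimality.\<close>

lemma interval_cover_overlap_two:
  fixes F :: "real set set"
  assumes "finite F" and F: "\<And>I. I \<in> F \<Longrightarrow> \<exists>a b. I = {a<..<b}"
  obtains G where "G \<subseteq> F" "\<Union>G = \<Union>F" "\<And>x. card {I \<in> G. x \<in> I} \<le> 2"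
proof -
  obtain a b where ab: "\<And>I. I \<in> F \<Longrightarrow> I = {a I<..<b I}"
    using F by metis
  obtain G where G: "G \<subseteq> F" "\<Union>G = \<Union>F"
    and least: "\<And>G'. G' \<subseteq> F \<Longrightarrow> \<Union>G' = \<Union>F \<Longrightarrow> card G \<le> card G'"
    using ex_has_least_nat[of "\<lambda>G. G \<subseteq> F \<and> \<Union>G = \<Union>F" F card] by auto
  have "card {I \<in> G. x \<in> I} \<le> 2" for x
  proof (rule ccontr)
    let ?T = "{I \<in> G. x \<in> I}"
    assume "\<not> card ?T \<le> 2"
    then have card: "2 < card ?T" by simp
    then have ne: "?T \<noteq> {}" by (metis card.empty not_less_zero)
    have fin: "finite ?T" "finite G"
      using \<open>finite F\<close> G(1) by (auto intro: finite_subset)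
    obtain P where P: "P \<in> ?T" "\<And>I. I \<in> ?T \<Longrightarrow> a P \<le> a I"
      using ex_is_arg_min_if_finite[OF fin(1) ne, of a] by (auto simp: is_arg_min_linorder)
    obtain Q where Q: "Q \<in> ?T" "\<And>I. I \<in> ?T \<Longrightarrow> b I \<le> b Q"
      using ex_is_arg_min_if_finite[OF fin(1) ne, of "\<lambda>I. - b I"] by (auto simp: is_arg_min_linorder)
    have "card {P, Q} \<le> 2"
      by (simp add: card_insert_if)
    then have "\<not> ?T \<subseteq> {P, Q}"
      using card card_mono[of "{P, Q}" ?T] by auto
    then obtain R where R: "R \<in> ?T" "R \<noteq> P" "R \<noteq> Q"
      by auto
    have "R \<subseteq> P \<union> Q"
    proof
      fix y assume "y \<in> R"
      moreover have "R = {a R<..<b R}" "P = {a P<..<b P}" "Q = {a Q<..<b Q}"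
        using R P Q G ab by blast+
      moreover have "a P \<le> a R" "b R \<le> b Q" "x \<in> P" "x \<in> Q"
        using P Q R by auto
      ultimately show "y \<in> P \<union> Q"
        by (smt (verit) Un_iff greaterThanLessThan_iff)
    qed
    moreover have "P \<in> G - {R}" "Q \<in> G - {R}"
      using P(1) Q(1) R(2,3) by auto
    ultimately have "\<Union>(G - {R}) = \<Union>G"
      by blast
    moreover have "G - {R} \<subseteq> F"
      using G(1) by auto
    ultimately have "card G \<le> card (G - {R})"
      using least[of "G - {R}"] G(2) by simp
    moreover have "card (G - {R}) < card G"
      using R(1) fin(2) by (intro card_Diff1_less) auto
    ultimately show False by simp
  qed
  then show ?thesis by (rule that[OF G])
qed

lemma less_divide_ennreal_imp_mult_le:
  fixes t a b :: ennreal
  assumes "t < a / b"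
  shows "t * b \<le> a"
proof (rule ccontr)
  assume "\<not> t * b \<le> a"
  then have "a \<le> b * t" "b \<noteq> 0"
    by (auto simp: mult.commute)
  then have "a / b \<le> t"
    by (intro divide_le_posI_ennreal) (simp_all add: zero_less_iff_neq_zero)
  with assms show False by simp
qed

text \<open>After thinning the family to overlap at most two, the integrals of f over its members
  add up to at most twice the total integral.\<close>

lemma maximal_weak_type_finite:
  assumes F: "finite F" "F \<subseteq> intervals_of \<nu>" and sets: "intervals_of \<nu> \<subseteq> sets \<nu>"
    and f[measurable]: "f \<in> borel_measurable \<nu>"
    and t: "\<And>I. I \<in> F \<Longrightarrow> t * emeasure \<nu> I \<le> (\<integral>\<^sup>+y\<in>I. f y \<partial>\<nu>)"
  shows "t * emeasure \<nu> (\<Union>F) \<le> 2 * (\<integral>\<^sup>+y. f y \<partial>\<nu>)"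
proof -
  obtain G where G: "G \<subseteq> F" "\<Union>G = \<Union>F" "\<And>x. card {I \<in> G. x \<in> I} \<le> 2"
  proof (rule interval_cover_overlap_two[of F])
    show "\<exists>a b. I = {a<..<b}" if "I \<in> F" for I
      using that F(2) unfolding intervals_of_def by blast
  qed (use F in auto)
  have finG: "finite G" using G F finite_subset by blast
  have Gs: "G \<subseteq> sets \<nu>" using G F sets by blast
  have "emeasure \<nu> (\<Union>F) \<le> (\<Sum>I\<in>G. emeasure \<nu> I)"
    using emeasure_subadditive_finite[of G "\<lambda>I. I" \<nu>] finG Gs G(2) by auto
  then have "t * emeasure \<nu> (\<Union>F) \<le> t * (\<Sum>I\<in>G. emeasure \<nu> I)"
    by (rule mult_left_mono) auto
  also have "\<dots> = (\<Sum>I\<in>G. t * emeasure \<nu> I)"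
    by (simp add: sum_distrib_left)
  also have "\<dots> \<le> (\<Sum>I\<in>G. \<integral>\<^sup>+y. f y * indicator I y \<partial>\<nu>)"
    using G t by (intro sum_mono) auto
  also have "\<dots> = (\<integral>\<^sup>+y. (\<Sum>I\<in>G. f y * indicator I y) \<partial>\<nu>)"
    using Gs by (intro nn_integral_sum[symmetric] borel_measurable_times_ennreal f borel_measurable_indicator) auto
  also have "\<dots> \<le> (\<integral>\<^sup>+y. 2 * f y \<partial>\<nu>)"
  proof (rule nn_integral_mono)
    fix y
    have "(\<Sum>I\<in>G. f y * indicator I y) = f y * of_nat (card {I \<in> G. y \<in> I})"
      using finG by (simp add: indicator_def sum.If_cases Int_def flip: sum_distrib_left)
    also have "\<dots> \<le> f y * of_nat 2"
      by (intro mult_left_mono of_nat_mono G) auto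
    finally show "(\<Sum>I\<in>G. f y * indicator I y) \<le> 2 * f y"
      by (simp add: mult.commute)
  qed
  also have "\<dots> = 2 * (\<integral>\<^sup>+y. f y \<partial>\<nu>)"
    by (simp add: nn_integral_cmult)
  finally show ?thesis .
qed

lemma maximal_weak_type:
  assumes sets: "intervals_of \<nu> \<subseteq> sets \<nu>" and f: "f \<in> borel_measurable \<nu>"
  shows "t * emeasure \<nu> {x \<in> space \<nu>. t < maximal \<nu> f x} \<le> 2 * (\<integral>\<^sup>+y. f y \<partial>\<nu>)"
proof -
  define F where "F = {I \<in> intervals_of \<nu>. t < (\<integral>\<^sup>+y\<in>I. f y \<partial>\<nu>) / emeasure \<nu> I}"
  obtain F' where F': "F' \<subseteq> F" "countable F'" "\<Union>F' = \<Union>F"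
    by (rule countable_interval_cover[of F]) (auto simp: F_def)
  show ?thesis
  proof (cases "F' = {}")
    case True
    then show ?thesis
      using F'(3) unfolding maximal_superlevel F_def[symmetric] True by (metis Union_empty emeasure_empty mult_zero_right zero_le)
  next
    case False
    \<comment> \<open>Finite unions increasing to the whole superlevel set: the finite case and
      continuity of the measure from below give the general one.\<close>
    define A where "A n = \<Union>(from_nat_into F' ` {..n})" for n
    have range: "range (from_nat_into F') = F'"
      using F' False by (simp add: range_from_nat_into)
    have "range A \<subseteq> sets \<nu>"
    proof -
      have "from_nat_into F' i \<in> sets \<nu>" for i
        using range F'(1) sets by (auto simp: F_def)
      then show ?thesis by (auto simp: A_def)
    qed
    moreover have "incseq A"
      unfolding A_def incseq_def by (intro allI impI Union_mono image_mono) auto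
    ultimately have "(SUP n. emeasure \<nu> (A n)) = emeasure \<nu> (\<Union>n. A n)"
      by (rule SUP_emeasure_incseq)
    also have "(\<Union>n. A n) = \<Union>F"
    proof -
      have "(\<Union>n. A n) = \<Union>(range (from_nat_into F'))"
        unfolding A_def by auto
      then show ?thesis
        using range F'(3) by simp
    qed
    finally have "t * emeasure \<nu> (\<Union>F) = (SUP n. t * emeasure \<nu> (A n))"
      by (simp flip: SUP_mult_left_ennreal)
    also have "\<dots> \<le> 2 * (\<integral>\<^sup>+y. f y \<partial>\<nu>)"
      unfolding A_def
    proof (rule SUP_least, rule maximal_weak_type_finite[OF _ _ sets f])
      fix n
      have *: "from_nat_into F' ` {..n} \<subseteq> F"
        using range F'(1) by blast
      then show "from_nat_into F' ` {..n} \<subseteq> intervals_of \<nu>"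
        by (auto simp: F_def)
      show "t * emeasure \<nu> I \<le> (\<integral>\<^sup>+y\<in>I. f y \<partial>\<nu>)" if "I \<in> from_nat_into F' ` {..n}" for I
        using that * by (intro less_divide_ennreal_imp_mult_le) (auto simp: F_def)
    qed auto
    finally show ?thesis
      by (simp add: maximal_superlevel flip: F_def)
  qed
qed

section \<open>From weak to strong type by interpolation\<close>

text \<open>Tonelli's theorem applied to the region below the graph of g. The extra factor h lets
  one identity serve twice in the strong type bound: with h = 1 and exponent p to expand the left
  side, and with h = f, g = 2 f and exponent p - 1 to reassemble the right side.\<close>

lemma nn_integral_layer_cake:
  assumes "sigma_finite_measure \<nu>" and [measurable]: "g \<in> borel_measurable \<nu>" "h \<in> borel_measurable \<nu>"
    and s: "0 < s"
  shows "(\<integral>\<^sup>+x. h x * epowr (g x) s \<partial>\<nu>) = ennreal s *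
    (\<integral>\<^sup>+t. ennreal (t powr (s - 1)) * indicator {0<..} t *
        (\<integral>\<^sup>+x. h x * indicator {x. ennreal t < g x} x \<partial>\<nu>) \<partial>lborel)"
proof -
  interpret \<nu>: sigma_finite_measure \<nu> by fact
  interpret pair_sigma_finite \<nu> lborel ..
  let ?k = "\<lambda>x t. h x * (ennreal (t powr (s - 1)) * indicator {t. 0 < t \<and> ennreal t < g x} t)"
  have [measurable]: "(\<lambda>(x, t). ?k x t) \<in> borel_measurable (\<nu> \<Otimes>\<^sub>M lborel)"
    unfolding indicator_def by measurable
  have k: "?k x t = ennreal (t powr (s - 1)) * indicator {0<..} t * (h x * indicator {x. ennreal t < g x} x)" for x t
    by (auto simp: indicator_def mult_ac)
  have "epowr (g x) s = ennreal s * (\<integral>\<^sup>+t. ennreal (t powr (s - 1)) * indicator {t. 0 < t \<and> ennreal t < g x} t \<partial>lborel)" for x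
    using s unfolding nn_integral_powr_below[OF s]
    by (subst mult.left_commute) (simp flip: ennreal_mult)
  then have "h x * epowr (g x) s = ennreal s * (\<integral>\<^sup>+t. ?k x t \<partial>lborel)" for x
    by (simp add: nn_integral_cmult mult_ac)
  then have "(\<integral>\<^sup>+x. h x * epowr (g x) s \<partial>\<nu>) = ennreal s * (\<integral>\<^sup>+x. (\<integral>\<^sup>+t. ?k x t \<partial>lborel) \<partial>\<nu>)"
    by (simp add: nn_integral_cmult)
  also have "(\<integral>\<^sup>+x. (\<integral>\<^sup>+t. ?k x t \<partial>lborel) \<partial>\<nu>) = (\<integral>\<^sup>+t. (\<integral>\<^sup>+x. ?k x t \<partial>\<nu>) \<partial>lborel)"
    by (intro Fubini'[symmetric]) measurable
  also have "(\<lambda>t. \<integral>\<^sup>+x. ?k x t \<partial>\<nu>) = (\<lambda>t. ennreal (t powr (s - 1)) * indicator {0<..} t *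
        (\<integral>\<^sup>+x. h x * indicator {x. ennreal t < g x} x \<partial>\<nu>))"
    unfolding k by (intro ext nn_integral_cmult) measurable
  finally show ?thesis .
qed

text \<open>The Marcinkiewicz splitting: the part of f below t / 2 adds at most t / 2 to the maximal
  function, so only the part above t / 2 has to reach the level t / 2. The 4 is the weak type
  constant 2 times the 2 from halving the level.\<close>

lemma maximal_weak_type_truncated:
  assumes sets: "intervals_of \<nu> \<subseteq> sets \<nu>" and f[measurable]: "f \<in> borel_measurable \<nu>" and t: "0 < t"
  shows "ennreal t * emeasure \<nu> {x \<in> space \<nu>. ennreal t < maximal \<nu> f x}
    \<le> 4 * (\<integral>\<^sup>+x. f x * indicator {x. ennreal t < 2 * f x} x \<partial>\<nu>)"
proof -
  define h where "h = (\<lambda>x. f x * indicator {x. ennreal t < 2 * f x} x)"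
  have [measurable]: "h \<in> borel_measurable \<nu>"
    unfolding h_def indicator_def by measurable
  have f_le: "f x \<le> h x + ennreal (t / 2)" for x
    using t by (cases "f x") (auto simp: h_def indicator_def ennreal_less_iff simp flip: ennreal_mult' ennreal_numeral)
  have max_le: "maximal \<nu> f x \<le> maximal \<nu> h x + ennreal (t / 2)" for x
    unfolding maximal_def[of \<nu> f]
  proof (rule SUP_least)
    fix I assume I: "I \<in> {I \<in> intervals_of \<nu>. x \<in> I}"
    then have [measurable]: "I \<in> sets \<nu>" using sets by auto
    have "(\<integral>\<^sup>+y\<in>I. f y \<partial>\<nu>) \<le> (\<integral>\<^sup>+y. h y * indicator I y + ennreal (t / 2) * indicator I y \<partial>\<nu>)"
      using f_le by (intro nn_integral_mono) (auto simp: indicator_def)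
    also have "\<dots> = (\<integral>\<^sup>+y\<in>I. h y \<partial>\<nu>) + ennreal (t / 2) * emeasure \<nu> I"
      by (simp add: nn_integral_add nn_integral_cmult)
    finally have "(\<integral>\<^sup>+y\<in>I. f y \<partial>\<nu>) / emeasure \<nu> I
        \<le> (\<integral>\<^sup>+y\<in>I. h y \<partial>\<nu>) / emeasure \<nu> I + ennreal (t / 2) * (emeasure \<nu> I / emeasure \<nu> I)"
      by (simp add: divide_right_mono_ennreal ennreal_times_divide flip: add_divide_distrib_ennreal)
    also have "emeasure \<nu> I / emeasure \<nu> I \<le> 1"
      by (cases "emeasure \<nu> I = 0"; cases "emeasure \<nu> I = top") (auto simp: less_top)
    also have "(\<integral>\<^sup>+y\<in>I. h y \<partial>\<nu>) / emeasure \<nu> I \<le> maximal \<nu> h x"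
      using I by (intro average_le_maximal) auto
    finally show "(\<integral>\<^sup>+y\<in>I. f y \<partial>\<nu>) / emeasure \<nu> I \<le> maximal \<nu> h x + ennreal (t / 2)"
      by (simp add: add_mono mult_left_mono)
  qed
  have "ennreal (t / 2) < maximal \<nu> h x" if "ennreal t < maximal \<nu> f x" for x
  proof (rule ccontr)
    assume "\<not> ?thesis"
    then have "maximal \<nu> f x \<le> ennreal (t / 2) + ennreal (t / 2)"
      by (intro order_trans[OF max_le] add_mono) auto
    then show False
      using that t by (simp flip: ennreal_plus)
  qed
  moreover have [measurable]: "maximal \<nu> h \<in> borel_measurable \<nu>"
    by (rule maximal_measurable[OF sets])
  ultimately have "emeasure \<nu> {x \<in> space \<nu>. ennreal t < maximal \<nu> f x}
      \<le> emeasure \<nu> {x \<in> space \<nu>. ennreal (t / 2) < maximal \<nu> h x}"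
    by (intro emeasure_mono) auto
  then have "ennreal t * emeasure \<nu> {x \<in> space \<nu>. ennreal t < maximal \<nu> f x}
      \<le> 2 * (ennreal (t / 2) * emeasure \<nu> {x \<in> space \<nu>. ennreal (t / 2) < maximal \<nu> h x})"
    using t by (simp add: mult_left_mono mult.assoc[symmetric] ennreal_mult[symmetric] flip: ennreal_numeral)
  also have "\<dots> \<le> 2 * (2 * (\<integral>\<^sup>+x. h x \<partial>\<nu>))"
    by (intro mult_left_mono maximal_weak_type[OF sets]) auto
  finally show ?thesis
    by (simp add: h_def mult.assoc[symmetric])
qed

text \<open>In the constant, p comes from expanding the left side, 4 from the truncated weak type
  bound, 1 / (p - 1) from reassembling the powers of t with exponent p - 1, and
  \<open>2 powr (p - 1)\<close> from the threshold 2 f.\<close>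

theorem maximal_strong_type:
  assumes "finite_measure \<nu>" and sets: "intervals_of \<nu> \<subseteq> sets \<nu>"
    and f[measurable]: "f \<in> borel_measurable \<nu>" and p: "1 < p"
  shows "(\<integral>\<^sup>+x. epowr (maximal \<nu> f x) p \<partial>\<nu>)
    \<le> ennreal (4 * p * 2 powr (p - 1) / (p - 1)) * (\<integral>\<^sup>+x. epowr (f x) p \<partial>\<nu>)"
proof -
  interpret finite_measure \<nu> by fact
  have sf: "sigma_finite_measure \<nu>" by unfold_locales
  have [measurable]: "maximal \<nu> f \<in> borel_measurable \<nu>"
    by (rule maximal_measurable[OF sets])
  let ?J = "\<lambda>t. \<integral>\<^sup>+x. f x * indicator {x. ennreal t < 2 * f x} x \<partial>\<nu>"
  have "(\<integral>\<^sup>+x. epowr (maximal \<nu> f x) p \<partial>\<nu>) = ennreal p *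
      (\<integral>\<^sup>+t. ennreal (t powr (p - 1)) * indicator {0<..} t *
        (\<integral>\<^sup>+x. 1 * indicator {x. ennreal t < maximal \<nu> f x} x \<partial>\<nu>) \<partial>lborel)"
    using nn_integral_layer_cake[OF sf, of "maximal \<nu> f" "\<lambda>_. 1" p] p by simp
  also have "\<dots> \<le> ennreal p * (\<integral>\<^sup>+t. 4 * (ennreal (t powr (p - 1 - 1)) * indicator {0<..} t * ?J t) \<partial>lborel)"
  proof (intro mult_left_mono nn_integral_mono)
    fix t :: real
    show "ennreal (t powr (p - 1)) * indicator {0<..} t * (\<integral>\<^sup>+x. 1 * indicator {x. ennreal t < maximal \<nu> f x} x \<partial>\<nu>)
        \<le> 4 * (ennreal (t powr (p - 1 - 1)) * indicator {0<..} t * ?J t)"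
    proof (cases "0 < t")
      case True
      have "(\<integral>\<^sup>+x. 1 * indicator {x. ennreal t < maximal \<nu> f x} x \<partial>\<nu>)
          = (\<integral>\<^sup>+x. indicator {x \<in> space \<nu>. ennreal t < maximal \<nu> f x} x \<partial>\<nu>)"
        by (intro nn_integral_cong) (auto simp: indicator_def)
      also have "\<dots> = emeasure \<nu> {x \<in> space \<nu>. ennreal t < maximal \<nu> f x}"
        by (rule nn_integral_indicator) measurable
      finally have *: "(\<integral>\<^sup>+x. 1 * indicator {x. ennreal t < maximal \<nu> f x} x \<partial>\<nu>)
          = emeasure \<nu> {x \<in> space \<nu>. ennreal t < maximal \<nu> f x}" .
      have "t powr (p - 1) = t powr (p - 1 - 1) * t"
        using True powr_add[of t "p - 1 - 1" 1] by simp
      then have "ennreal (t powr (p - 1)) * emeasure \<nu> {x \<in> space \<nu>. ennreal t < maximal \<nu> f x}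
         = ennreal (t powr (p - 1 - 1)) * (ennreal t * emeasure \<nu> {x \<in> space \<nu>. ennreal t < maximal \<nu> f x})"
        using True by (simp add: ennreal_mult mult.assoc)
      also have "\<dots> \<le> ennreal (t powr (p - 1 - 1)) * (4 * ?J t)"
        using True by (intro mult_left_mono maximal_weak_type_truncated[OF sets f]) auto
      finally show ?thesis
        using True unfolding * by (simp add: mult.left_commute)
    qed simp
  qed simp
  also have "\<dots> = ennreal p * (4 * (\<integral>\<^sup>+t. (ennreal (t powr (p - 1 - 1)) * indicator {0<..} t * ?J t) \<partial>lborel))"
    by (subst nn_integral_cmult) auto
  also have "\<dots> = ennreal (4 * p / (p - 1)) * (ennreal (p - 1) * (\<integral>\<^sup>+t. (ennreal (t powr (p - 1 - 1)) * indicator {0<..} t * ?J t) \<partial>lborel))"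
  proof -
    have "ennreal p * ennreal 4 = ennreal (4 * p / (p - 1)) * ennreal (p - 1)"
      using p by (simp add: mult.commute[of p] del: ennreal_numeral flip: ennreal_mult)
    then show ?thesis
      by (simp only: mult.assoc[symmetric] ennreal_numeral)
  qed
  also have "\<dots> = ennreal (4 * p / (p - 1)) * (\<integral>\<^sup>+x. f x * epowr (2 * f x) (p - 1) \<partial>\<nu>)"
    using p by (subst nn_integral_layer_cake[OF sf, of "\<lambda>x. 2 * f x"]) auto
  also have "(\<lambda>x. f x * epowr (2 * f x) (p - 1)) = (\<lambda>x. ennreal (2 powr (p - 1)) * epowr (f x) p)"
  proof
    fix x
    have "epowr (f x) p = f x * epowr (f x) (p - 1)"
      using epowr_add[of 1 "p - 1" "f x"] p by simp
    moreover have "epowr 2 (p - 1) = ennreal (2 powr (p - 1))"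
      using epowr_real[of "p - 1" 2] p by simp
    ultimately show "f x * epowr (2 * f x) (p - 1) = ennreal (2 powr (p - 1)) * epowr (f x) p"
      using p by (simp add: epowr_mult mult_ac)
  qed
  finally show ?thesis
    using p by (simp add: nn_integral_cmult mult.assoc[symmetric] ennreal_mult[symmetric])
qed

subsection \<open>Weighted bounds for the maximal operator\<close>

lemma ennreal_mult_divide_cancel: "0 < c \<Longrightarrow> ennreal c * (x / ennreal c) = x"
  by (simp add: ennreal_times_divide mult.commute[of "ennreal c"] ennreal_mult_divide_eq)

text \<open>What the weighted estimates use of the Jacobi measure. Positivity on intervals excludes
  averages of the form 0 / 0 and makes an a.e. statement on an interval apply to at least one
  point.\<close>

locale interval_space = finite_measure \<mu> for \<mu> :: "real measure" +
  assumes sets: "intervals_of \<mu> \<subseteq> sets \<mu>"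
    and positive: "I \<in> intervals_of \<mu> \<Longrightarrow> emeasure \<mu> I \<noteq> 0"
begin

definition dual_weight :: "real \<Rightarrow> (real \<Rightarrow> real) \<Rightarrow> real \<Rightarrow> real" where
  "dual_weight p w x = w x powr (- 1 / (p - 1))"

text \<open>The A_p condition with the denominators cleared, which avoids division in
  \<open>ennreal\<close>. Weights are positive reals everywhere, and both integrals are finite over
  the whole space rather than locally.\<close>

definition Ap :: "real \<Rightarrow> (real \<Rightarrow> real) \<Rightarrow> bool" where
  "Ap p w \<longleftrightarrow> w \<in> borel_measurable \<mu> \<and> (\<forall>x. 0 < w x) \<and>
     (\<integral>\<^sup>+x. w x \<partial>\<mu>) < top \<and> (\<integral>\<^sup>+x. dual_weight p w x \<partial>\<mu>) < top \<and>
     (\<exists>K::real. 0 < K \<and> (\<forall>I\<in>intervals_of \<mu>.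
        (\<integral>\<^sup>+x\<in>I. w x \<partial>\<mu>) * epowr (\<integral>\<^sup>+x\<in>I. dual_weight p w x \<partial>\<mu>) (p - 1) \<le> K * epowr (emeasure \<mu> I) p))"

lemma dual_weight_pos: "0 < w x \<Longrightarrow> 0 < dual_weight p w x"
  by (simp add: dual_weight_def)

lemma dual_weight_measurable [measurable]:
  assumes [measurable]: "w \<in> borel_measurable \<mu>"
  shows "dual_weight p w \<in> borel_measurable \<mu>"
  unfolding dual_weight_def by measurable

lemma dual_dual_weight:
  assumes "1 < p" and "0 < w x"
  shows "dual_weight (p / (p - 1)) (dual_weight p w) x = w x"
proof -
  have "- 1 / (p - 1) * (- 1 / (p / (p - 1) - 1)) = 1"
    using assms by (simp add: field_simps)
  then show ?thesis
    using assms by (simp add: dual_weight_def powr_powr del: times_divide_eq_left times_divide_eq_right)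
qed

text \<open>Raising the condition to the power 1 / (p - 1) = p' - 1 exchanges the roles of w and its
  dual, with constant \<open>K powr (1 / (p - 1))\<close>.\<close>

lemma Ap_dual:
  assumes p: "1 < p" and w: "Ap p w"
  shows "Ap (p / (p - 1)) (dual_weight p w)"
proof -
  have pos: "\<And>x. 0 < w x"
    using w by (simp add: Ap_def)
  have dd: "dual_weight (p / (p - 1)) (dual_weight p w) = w"
    by (simp add: fun_eq_iff dual_dual_weight p pos)
  have exps: "p / (p - 1) - 1 = 1 / (p - 1)" "0 < 1 / (p - 1)" "(p - 1) * (1 / (p - 1)) = 1"
    using p by (simp_all add: field_simps)
  obtain K :: real where K: "0 < K" "\<And>I. I \<in> intervals_of \<mu> \<Longrightarrow>
      (\<integral>\<^sup>+x\<in>I. w x \<partial>\<mu>) * epowr (\<integral>\<^sup>+x\<in>I. dual_weight p w x \<partial>\<mu>) (p - 1) \<le> K * epowr (emeasure \<mu> I) p"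
    using w by (auto simp: Ap_def)
  have "(\<integral>\<^sup>+x\<in>I. dual_weight p w x \<partial>\<mu>) * epowr (\<integral>\<^sup>+x\<in>I. w x \<partial>\<mu>) (1 / (p - 1))
      \<le> ennreal (K powr (1 / (p - 1))) * epowr (emeasure \<mu> I) (p / (p - 1))" if I: "I \<in> intervals_of \<mu>" for I
  proof -
    have "epowr ((\<integral>\<^sup>+x\<in>I. w x \<partial>\<mu>) * epowr (\<integral>\<^sup>+x\<in>I. dual_weight p w x \<partial>\<mu>) (p - 1)) (1 / (p - 1))
        \<le> epowr (K * epowr (emeasure \<mu> I) p) (1 / (p - 1))"
      by (rule epowr_mono[OF exps(2) K(2)[OF I]])
    then show ?thesis
      using p exps K(1) by (simp add: epowr_mult epowr_epowr epowr_ennreal mult.commute)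
  qed
  then show ?thesis
    using w K(1) p unfolding Ap_def dd exps(1)
    by (auto simp: dual_weight_pos intro!: exI[of _ "K powr (1 / (p - 1))"])
qed

lemma interval_measure: "I \<in> intervals_of \<mu> \<Longrightarrow> \<exists>m>0. emeasure \<mu> I = ennreal m"
  using positive[of I] emeasure_finite[of I]
  by (cases "emeasure \<mu> I") (auto simp: zero_less_iff_neq_zero intro!: exI simp flip: top_unique intro: less_le_trans)

lemma interval_integral_nonzero:
  assumes I: "I \<in> intervals_of \<mu>" and w[measurable]: "w \<in> borel_measurable \<mu>"
    and pos: "\<And>x. 0 < w x"
  shows "(\<integral>\<^sup>+x\<in>I. ennreal (w x) \<partial>\<mu>) \<noteq> 0"
proof
  have [measurable]: "I \<in> sets \<mu>" using I sets by auto
  assume "(\<integral>\<^sup>+x\<in>I. w x \<partial>\<mu>) = 0"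
  then have "AE x in \<mu>. ennreal (w x) * indicator I x = 0"
    by (subst (asm) nn_integral_0_iff_AE) auto
  then have "AE x in \<mu>. x \<notin> I"
  proof eventually_elim
    case (elim x)
    then show ?case
      using pos[of x] by (auto simp: indicator_def ennreal_eq_0_iff)
  qed
  then have "emeasure \<mu> I = 0"
    using AE_iff_null_sets[of I \<mu>] by (simp add: null_sets_def)
  then show False using positive[OF I] by simp
qed

lemma interval_weight:
  assumes I: "I \<in> intervals_of \<mu>" and w: "w \<in> borel_measurable \<mu>"
    and pos: "\<And>x. 0 < w x" and fin: "(\<integral>\<^sup>+x. ennreal (w x) \<partial>\<mu>) < top"
  shows "\<exists>m>0. (\<integral>\<^sup>+x\<in>I. w x \<partial>\<mu>) = ennreal m"
proof -
  have "(\<integral>\<^sup>+x\<in>I. w x \<partial>\<mu>) < top"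
    by (rule le_less_trans[OF _ fin]) (auto intro!: nn_integral_mono simp: indicator_def)
  with interval_integral_nonzero[OF I w pos] show ?thesis
    by (cases "\<integral>\<^sup>+x\<in>I. w x \<partial>\<mu>") (auto simp: less_le)
qed

lemma finite_measure_weight:
  assumes [measurable]: "w \<in> borel_measurable \<mu>" and fin: "(\<integral>\<^sup>+x. ennreal (w x) \<partial>\<mu>) < top"
  shows "finite_measure (density \<mu> w)"
proof
  have "emeasure (density \<mu> w) (space \<mu>) = (\<integral>\<^sup>+x. ennreal (w x) \<partial>\<mu>)"
    by (subst emeasure_density) (auto intro!: nn_integral_cong)
  then show "emeasure (density \<mu> w) (space (density \<mu> w)) \<noteq> \<infinity>"
    using fin by simp
qed

section \<open>Lerner's inequality and the weighted maximal theorem\<close>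

text \<open>For an interval I let m, v, s be its masses under \<mu>, w, \<sigma>, and F the integral
  of f over I. Then F / m = (F / s) (s / m), where F / s is a \<sigma>-average and the A_p condition
  bounds (s / m)^(p-1) by K m / v. The factor m / v turns a \<mu>-average over I into a w-average of
  the function divided by w.\<close>

lemma lerner_pointwise:
  assumes p: "1 < p" and w: "Ap p w"
  obtains K :: real where "0 < K" and "\<And>f x. f \<in> borel_measurable \<mu> \<Longrightarrow>
    maximal \<mu> f x \<le> epowr (ennreal K * maximal (density \<mu> w)
      (\<lambda>y. epowr (maximal (density \<mu> (dual_weight p w)) (\<lambda>z. f z / dual_weight p w z) y) (p - 1) / w y) x) (1 / (p - 1))"
proof -
  let ?\<sigma> = "dual_weight p w"
  obtain K :: real where K: "0 < K" "\<And>I. I \<in> intervals_of \<mu> \<Longrightarrow>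
      (\<integral>\<^sup>+x\<in>I. w x \<partial>\<mu>) * epowr (\<integral>\<^sup>+x\<in>I. ?\<sigma> x \<partial>\<mu>) (p - 1) \<le> K * epowr (emeasure \<mu> I) p"
    using w by (auto simp: Ap_def)
  have [measurable]: "w \<in> borel_measurable \<mu>" and wpos: "\<And>x. 0 < w x"
    and wfin: "(\<integral>\<^sup>+x. w x \<partial>\<mu>) < top" "(\<integral>\<^sup>+x. ?\<sigma> x \<partial>\<mu>) < top"
    using w by (auto simp: Ap_def)
  have spos: "\<And>x. 0 < ?\<sigma> x" using wpos by (simp add: dual_weight_pos)
  have "maximal \<mu> f x \<le> epowr (ennreal K * maximal (density \<mu> w)
      (\<lambda>y. epowr (maximal (density \<mu> ?\<sigma>) (\<lambda>z. f z / ?\<sigma> z) y) (p - 1) / w y) x) (1 / (p - 1))"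
    if [measurable]: "f \<in> borel_measurable \<mu>" for f x
    unfolding maximal_def[of \<mu> f]
  proof (rule SUP_least)
    define G where "G = maximal (density \<mu> ?\<sigma>) (\<lambda>z. f z / ?\<sigma> z)"
    have [measurable]: "G \<in> borel_measurable \<mu>"
      using maximal_measurable[of "density \<mu> ?\<sigma>"] sets by (simp add: G_def)
    fix I assume "I \<in> {I \<in> intervals_of \<mu>. x \<in> I}"
    then have I: "I \<in> intervals_of \<mu>" "x \<in> I" by auto
    have [measurable]: "I \<in> sets \<mu>" using I sets by auto
    obtain m v s where m: "0 < m" "emeasure \<mu> I = ennreal m"
      and v: "0 < v" "(\<integral>\<^sup>+x\<in>I. w x \<partial>\<mu>) = ennreal v"
      and s: "0 < s" "(\<integral>\<^sup>+x\<in>I. ?\<sigma> x \<partial>\<mu>) = ennreal s"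
      using interval_measure[OF I(1)] interval_weight[OF I(1), of w] interval_weight[OF I(1), of ?\<sigma>]
        wpos spos wfin by auto
    have Ap: "v * s powr (p - 1) \<le> K * m powr p"
      using K(2)[OF I(1)] K(1) p m v s by (simp add: epowr_real flip: ennreal_mult)
    \<comment> \<open>The density \<sigma> cancels the division of f by \<sigma>, so F / s is an
      average for \<sigma> and bounds G from below at every point of I, not only at x.\<close>
    let ?F = "\<integral>\<^sup>+y\<in>I. f y \<partial>\<mu>"
    have "(\<integral>\<^sup>+y\<in>I. (f y / ?\<sigma> y) \<partial>density \<mu> ?\<sigma>) = ?F"
      using spos by (subst nn_integral_density)
        (auto intro!: nn_integral_cong simp: indicator_def ennreal_mult_divide_cancel mult.assoc[symmetric])
    moreover have "emeasure (density \<mu> ?\<sigma>) I = ennreal s"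
      using s by (simp add: emeasure_density)
    ultimately have G: "?F / s \<le> G y" if "y \<in> I" for y
      using average_le_maximal[of I "density \<mu> ?\<sigma>" y "\<lambda>z. f z / ?\<sigma> z"] I that by (simp add: G_def)
    \<comment> \<open>The constant F / s is integrated over I to bring in the values of G, and w is
      inserted as density and divisor at once.\<close>
    have "epowr (?F / s) (p - 1) * m = (\<integral>\<^sup>+y\<in>I. epowr (?F / s) (p - 1) \<partial>\<mu>)"
      by (simp add: nn_integral_cmult m)
    also have "\<dots> \<le> (\<integral>\<^sup>+y\<in>I. epowr (G y) (p - 1) \<partial>\<mu>)"
      using p by (intro nn_integral_mono) (auto split: split_indicator intro!: epowr_mono G)
    also have "\<dots> = (\<integral>\<^sup>+y\<in>I. (epowr (G y) (p - 1) / w y) \<partial>density \<mu> w)"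
      using wpos by (subst nn_integral_density)
        (auto intro!: nn_integral_cong simp: indicator_def ennreal_mult_divide_cancel mult.assoc[symmetric])
    finally have "epowr (?F / s) (p - 1) * m / v \<le> (\<integral>\<^sup>+y\<in>I. (epowr (G y) (p - 1) / w y) \<partial>density \<mu> w) / v"
      by (rule divide_right_mono_ennreal)
    also have "\<dots> \<le> maximal (density \<mu> w) (\<lambda>y. epowr (G y) (p - 1) / w y) x"
      using average_le_maximal[of I "density \<mu> w" x] I v by (simp add: emeasure_density)
    finally have *: "epowr (?F / s) (p - 1) * m / v \<le> maximal (density \<mu> w) (\<lambda>y. epowr (G y) (p - 1) / w y) x" .
    have "(s / m) powr (p - 1) \<le> K * m / v"
      using Ap m v s p by (simp add: powr_divide powr_diff field_simps)
    then have "epowr (ennreal (s / m)) (p - 1) \<le> ennreal (K * m / v)"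
      using p s m by (simp add: epowr_real ennreal_leI)
    moreover have "?F / m = ?F / s * ennreal (s / m)"
      using m s by (simp add: divide_ennreal_def inverse_ennreal mult.assoc flip: ennreal_mult)
        (simp add: field_simps)
    ultimately have "epowr (?F / m) (p - 1) \<le> epowr (?F / s) (p - 1) * ennreal (K * m / v)"
      using p by (simp add: epowr_mult mult_left_mono)
    also have "\<dots> = ennreal K * (epowr (?F / s) (p - 1) * m / v)"
      using K(1) m v by (simp add: ennreal_times_divide mult.left_commute[of "ennreal K"] divide_ennreal_def inverse_ennreal mult.assoc flip: ennreal_mult)
         (simp add: field_simps)
    also have "\<dots> \<le> ennreal K * maximal (density \<mu> w) (\<lambda>y. epowr (G y) (p - 1) / w y) x"
      by (intro mult_left_mono *) auto
    finally have "epowr (epowr (?F / m) (p - 1)) (1 / (p - 1)) \<le> epowr (ennreal K * maximal (density \<mu> w) (\<lambda>y. epowr (G y) (p - 1) / w y) x) (1 / (p - 1))"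
      using p by (intro epowr_mono) auto
    then show "?F / emeasure \<mu> I \<le> epowr (ennreal K * maximal (density \<mu> w)
      (\<lambda>y. epowr (maximal (density \<mu> ?\<sigma>) (\<lambda>z. f z / ?\<sigma> z) y) (p - 1) / w y) x) (1 / (p - 1))"
      using p by (simp add: epowr_epowr m G_def)
  qed
  with K(1) that show ?thesis by blast
qed

text \<open>The p-th power of Lerner's bound carries the exponent p' = p / (p - 1) on the w-maximal
  function. Undoing that operator on L^p'(w) leaves w (G^(p-1) / w)^p' = \<sigma> G^p; undoing the
  \<sigma>-maximal function on L^p(\<sigma>) leaves \<sigma> (f / \<sigma>)^p = f^p w.\<close>

theorem muckenhoupt_maximal:
  assumes p: "1 < p" and w: "Ap p w"
  obtains N :: real where "0 < N" and "\<And>f. f \<in> borel_measurable \<mu> \<Longrightarrow>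
    (\<integral>\<^sup>+x. epowr (maximal \<mu> f x) p * w x \<partial>\<mu>) \<le> ennreal N * (\<integral>\<^sup>+x. epowr (f x) p * w x \<partial>\<mu>)"
proof -
  let ?\<sigma> = "dual_weight p w" and ?q = "p / (p - 1)"
  have q: "1 < ?q" using p by simp
  have [measurable]: "w \<in> borel_measurable \<mu>" and wpos: "\<And>x. 0 < w x"
    and wfin: "(\<integral>\<^sup>+x. w x \<partial>\<mu>) < top" "(\<integral>\<^sup>+x. ?\<sigma> x \<partial>\<mu>) < top"
    using w by (auto simp: Ap_def)
  have spos: "\<And>x. 0 < ?\<sigma> x" using wpos by (simp add: dual_weight_pos)
  obtain K :: real where K: "0 < K" and lerner: "\<And>f x. f \<in> borel_measurable \<mu> \<Longrightarrow>
    maximal \<mu> f x \<le> epowr (ennreal K * maximal (density \<mu> w)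
      (\<lambda>y. epowr (maximal (density \<mu> ?\<sigma>) (\<lambda>z. f z / ?\<sigma> z) y) (p - 1) / w y) x) (1 / (p - 1))"
    by (rule lerner_pointwise[OF p w]) (rule that)
  have strong: "\<exists>C>0. \<forall>f\<in>borel_measurable \<mu>. (\<integral>\<^sup>+x. u x * epowr (maximal (density \<mu> u) f x) s \<partial>\<mu>)
      \<le> ennreal C * (\<integral>\<^sup>+x. u x * epowr (f x) s \<partial>\<mu>)"
    if [measurable]: "u \<in> borel_measurable \<mu>" and fin: "(\<integral>\<^sup>+x. ennreal (u x) \<partial>\<mu>) < top" and s: "1 < s"
    for u :: "real \<Rightarrow> real" and s
  proof (intro exI conjI ballI)
    show "0 < 4 * s * 2 powr (s - 1) / (s - 1)"
      using s by simp
    fix f :: "real \<Rightarrow> ennreal" assume [measurable]: "f \<in> borel_measurable \<mu>"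
    have sets': "intervals_of (density \<mu> u) \<subseteq> sets (density \<mu> u)"
      using sets by simp
    have [measurable]: "maximal (density \<mu> u) f \<in> borel_measurable \<mu>"
      using maximal_measurable[OF sets', of f] by simp
    show "(\<integral>\<^sup>+x. u x * epowr (maximal (density \<mu> u) f x) s \<partial>\<mu>)
        \<le> ennreal (4 * s * 2 powr (s - 1) / (s - 1)) * (\<integral>\<^sup>+x. u x * epowr (f x) s \<partial>\<mu>)"
      using maximal_strong_type[OF finite_measure_weight[OF _ fin] sets', of f s] s
      by (simp add: nn_integral_density)
  qed
  obtain A where A: "0 < A" "\<And>f. f \<in> borel_measurable \<mu> \<Longrightarrow>
      (\<integral>\<^sup>+x. w x * epowr (maximal (density \<mu> w) f x) ?q \<partial>\<mu>) \<le> ennreal A * (\<integral>\<^sup>+x. w x * epowr (f x) ?q \<partial>\<mu>)"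
    using strong[of w ?q] q wfin by auto
  obtain B where B: "0 < B" "\<And>f. f \<in> borel_measurable \<mu> \<Longrightarrow>
      (\<integral>\<^sup>+x. ?\<sigma> x * epowr (maximal (density \<mu> ?\<sigma>) f x) p \<partial>\<mu>) \<le> ennreal B * (\<integral>\<^sup>+x. ?\<sigma> x * epowr (f x) p \<partial>\<mu>)"
    using strong[of ?\<sigma> p] p wfin by auto
  show ?thesis
  proof
    show "0 < K powr ?q * A * B"
      using K A B by simp
    fix f :: "real \<Rightarrow> ennreal" assume [measurable]: "f \<in> borel_measurable \<mu>"
    define G where "G = maximal (density \<mu> ?\<sigma>) (\<lambda>z. f z / ?\<sigma> z)"
    define H where "H = maximal (density \<mu> w) (\<lambda>y. epowr (G y) (p - 1) / w y)"
    have [measurable]: "G \<in> borel_measurable \<mu>" "H \<in> borel_measurable \<mu>"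
      using maximal_measurable[of "density \<mu> ?\<sigma>"] maximal_measurable[of "density \<mu> w"] sets
      by (simp_all add: G_def H_def)
    have "(\<integral>\<^sup>+x. epowr (maximal \<mu> f x) p * w x \<partial>\<mu>) \<le> (\<integral>\<^sup>+x. epowr (epowr (ennreal K * H x) (1 / (p - 1))) p * w x \<partial>\<mu>)"
      using p lerner unfolding H_def G_def by (intro nn_integral_mono mult_right_mono epowr_mono) auto
    also have "\<dots> = (\<integral>\<^sup>+x. ennreal (K powr ?q) * (w x * epowr (H x) ?q) \<partial>\<mu>)"
      using p K by (simp add: epowr_epowr epowr_mult epowr_ennreal powr_powr mult_ac)
    also have "\<dots> = ennreal (K powr ?q) * (\<integral>\<^sup>+x. w x * epowr (H x) ?q \<partial>\<mu>)"
      by (rule nn_integral_cmult) measurable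
    also have "\<dots> \<le> ennreal (K powr ?q) * (ennreal A * (\<integral>\<^sup>+x. w x * epowr (epowr (G x) (p - 1) / w x) ?q \<partial>\<mu>))"
      unfolding H_def by (intro mult_left_mono A) auto
    also have "(\<integral>\<^sup>+x. w x * epowr (epowr (G x) (p - 1) / w x) ?q \<partial>\<mu>) = (\<integral>\<^sup>+x. ?\<sigma> x * epowr (G x) p \<partial>\<mu>)"
    proof (intro nn_integral_cong)
      fix x
      have "w x * (1 / w x) powr ?q = ?\<sigma> x"
      proof -
        have "w x * (1 / w x) powr ?q = w x powr (1 - ?q)"
          using wpos[of x] by (simp add: powr_divide powr_diff)
        also have "1 - ?q = - 1 / (p - 1)"
          using p by (simp add: field_simps)
        finally show ?thesis by (simp add: dual_weight_def)
      qed
      moreover have "epowr (G x) (p - 1) / w x = epowr (G x) (p - 1) * ennreal (1 / w x)"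
        using wpos[of x] by (simp add: divide_ennreal_def inverse_ennreal inverse_eq_divide)
      ultimately show "w x * epowr (epowr (G x) (p - 1) / w x) ?q = ?\<sigma> x * epowr (G x) p"
        using wpos[of x] p by (simp add: epowr_mult epowr_epowr epowr_ennreal mult.left_commute[of "ennreal (w x)"] mult.commute flip: ennreal_mult)
    qed
    also have "ennreal (K powr ?q) * (ennreal A * (\<integral>\<^sup>+x. ?\<sigma> x * epowr (G x) p \<partial>\<mu>))
        \<le> ennreal (K powr ?q) * (ennreal A * (ennreal B * (\<integral>\<^sup>+x. ?\<sigma> x * epowr (f x / ?\<sigma> x) p \<partial>\<mu>)))"
      unfolding G_def by (intro mult_left_mono B) auto
    also have "(\<integral>\<^sup>+x. ?\<sigma> x * epowr (f x / ?\<sigma> x) p \<partial>\<mu>) = (\<integral>\<^sup>+x. epowr (f x) p * w x \<partial>\<mu>)"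
    proof (intro nn_integral_cong)
      fix x
      have "?\<sigma> x * (1 / ?\<sigma> x) powr p = w x"
      proof -
        have "?\<sigma> x * (1 / ?\<sigma> x) powr p = ?\<sigma> x powr (1 - p)"
          using spos[of x] by (simp add: powr_divide powr_diff)
        also have "\<dots> = w x powr 1"
          using p wpos[of x] unfolding dual_weight_def powr_powr by (intro arg_cong2[where f="(powr)"]) (simp_all add: field_simps)
        finally show ?thesis using wpos[of x] by simp
      qed
      moreover have "f x / ?\<sigma> x = f x * ennreal (1 / ?\<sigma> x)"
        using spos[of x] by (simp add: divide_ennreal_def inverse_ennreal inverse_eq_divide)
      ultimately show "?\<sigma> x * epowr (f x / ?\<sigma> x) p = epowr (f x) p * w x"
        using spos[of x] p by (simp add: epowr_mult epowr_ennreal mult.left_commute[of "ennreal (?\<sigma> x)"] flip: ennreal_mult)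
    qed
    also have "ennreal (K powr ?q) * (ennreal A * (ennreal B * (\<integral>\<^sup>+x. epowr (f x) p * w x \<partial>\<mu>)))
        = ennreal (K powr ?q * A * B) * (\<integral>\<^sup>+x. epowr (f x) p * w x \<partial>\<mu>)"
      using A B by (simp add: ennreal_mult mult.assoc)
    finally show "(\<integral>\<^sup>+x. epowr (maximal \<mu> f x) p * w x \<partial>\<mu>) \<le> ennreal (K powr ?q * A * B) * (\<integral>\<^sup>+x. epowr (f x) p * w x \<partial>\<mu>)" .
  qed
qed

end

subsection \<open>Majorants in the class \<open>A\<^sub>1\<close>\<close>

lemma suminf_half_powers: "(\<Sum>k. ennreal ((1 / 2) ^ k)) = 2"
proof -
  have "(\<lambda>k. (1 / 2 :: real) ^ k) sums 2"
    using geometric_sums[of "1 / 2 :: real"] by simp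
  then have "(\<Sum>k. ennreal ((1 / 2) ^ k)) = ennreal 2"
    by (intro suminf_ennreal_eq) auto
  then show ?thesis by simp
qed

lemma suminf_ge_term: "f k \<le> (\<Sum>i. f i :: ennreal)"
  using sum_le_suminf[of f "{k}"] by simp

text \<open>Stands in for Minkowski's inequality: each b k is at most the p-th root of the sum of
  all p-th powers, and the geometric weights add up to 2.\<close>

lemma epowr_suminf_half_le:
  assumes "0 < p"
  shows "epowr (\<Sum>k. ennreal ((1 / 2) ^ k) * b k) p \<le> ennreal (2 powr p) * (\<Sum>k. epowr (b k) p)"
proof -
  let ?S = "\<Sum>k. epowr (b k) p"
  have "b k \<le> epowr ?S (1 / p)" for k
    using epowr_mono[OF _ suminf_ge_term[of "\<lambda>k. epowr (b k) p" k], of "1 / p"] assms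
    by (simp add: epowr_epowr)
  then have "(\<Sum>k. ennreal ((1 / 2) ^ k) * b k) \<le> (\<Sum>k. ennreal ((1 / 2) ^ k) * epowr ?S (1 / p))"
    by (intro suminf_le mult_left_mono) auto
  also have "\<dots> = 2 * epowr ?S (1 / p)"
    by (simp add: suminf_half_powers)
  finally have "epowr (\<Sum>k. ennreal ((1 / 2) ^ k) * b k) p \<le> epowr (2 * epowr ?S (1 / p)) p"
    by (rule epowr_mono[OF assms])
  also have "\<dots> = ennreal (2 powr p) * ?S"
    using assms epowr_ennreal[of 2 p] by (simp add: epowr_mult epowr_epowr)
  finally show ?thesis .
qed

context interval_space
begin

text \<open>The exceptional null set may depend on the interval, which suffices since the weight is
  tested on one interval at a time. Finiteness of the integrals is a consequence, see
  \<open>A1_integrable\<close>.\<close>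

definition A1 :: "(real \<Rightarrow> real) \<Rightarrow> bool" where
  "A1 H \<longleftrightarrow> H \<in> borel_measurable \<mu> \<and> (\<forall>x. 0 < H x) \<and>
     (\<exists>A::real. 0 < A \<and> (\<forall>I\<in>intervals_of \<mu>. AE x in \<mu>. x \<in> I \<longrightarrow>
        (\<integral>\<^sup>+y\<in>I. H y \<partial>\<mu>) \<le> A * H x * emeasure \<mu> I))"

lemma nn_integral_suminf_half_le:
  assumes p: "0 < p" and [measurable]: "\<And>k. b k \<in> borel_measurable \<mu>" "w \<in> borel_measurable \<mu>"
    and b: "\<And>k. (\<integral>\<^sup>+x. epowr (b k x) p * w x \<partial>\<mu>) \<le> B k"
  shows "(\<integral>\<^sup>+x. epowr (\<Sum>k. ennreal ((1 / 2) ^ k) * b k x) p * w x \<partial>\<mu>) \<le> ennreal (2 powr p) * (\<Sum>k. B k)"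
proof -
  have "(\<integral>\<^sup>+x. epowr (\<Sum>k. ennreal ((1 / 2) ^ k) * b k x) p * w x \<partial>\<mu>)
      \<le> (\<integral>\<^sup>+x. ennreal (2 powr p) * (\<Sum>k. epowr (b k x) p * w x) \<partial>\<mu>)"
    using epowr_suminf_half_le[OF p]
    by (intro nn_integral_mono) (auto simp: mult.assoc[symmetric] intro!: mult_right_mono)
  also have "\<dots> = ennreal (2 powr p) * (\<Sum>k. \<integral>\<^sup>+x. epowr (b k x) p * w x \<partial>\<mu>)"
    by (simp add: nn_integral_cmult nn_integral_suminf del: ennreal_suminf_multc)
  also have "\<dots> \<le> ennreal (2 powr p) * (\<Sum>k. B k)"
    by (intro mult_left_mono suminf_le b) auto
  finally show ?thesis .
qed

text \<open>Rubio de Francia's series: the sum of 2^(-k) c^k M^k h, with M the maximal operator.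
  Applying M shifts the series by one index, so the sum is an A_1 function; its term k = 0 is h
  itself.\<close>

lemma A1_majorant:
  assumes p: "1 < p" and w: "Ap p w" and h[measurable]: "h \<in> borel_measurable \<mu>"
    and h1: "\<And>x. 1 \<le> h x" and hfin: "(\<integral>\<^sup>+x. epowr (h x) p * w x \<partial>\<mu>) < top"
  obtains H where "A1 H" "AE x in \<mu>. h x \<le> ennreal (H x)"
    "(\<integral>\<^sup>+x. epowr (ennreal (H x)) p * w x \<partial>\<mu>) < top"
proof -
  have [measurable]: "w \<in> borel_measurable \<mu>" and wpos: "\<And>x. 0 < w x"
    using w by (auto simp: Ap_def)
  obtain N :: real where N: "0 < N" and max: "\<And>f. f \<in> borel_measurable \<mu> \<Longrightarrow>
      (\<integral>\<^sup>+x. epowr (maximal \<mu> f x) p * w x \<partial>\<mu>) \<le> ennreal N * (\<integral>\<^sup>+x. epowr (f x) p * w x \<partial>\<mu>)"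
    by (rule muckenhoupt_maximal[OF p w]) (rule that)
  \<comment> \<open>With this c, the p-th power integral against w is at least halved by each
    application of c M, so the bounds for b k decay geometrically.\<close>
  define c where "c = (1 / (2 * N)) powr (1 / p)"
  have c: "0 < c" "c powr p * N = 1 / 2"
    using N p by (simp_all add: c_def powr_powr)
  define b where "b k x = ennreal (c ^ k) * (maximal \<mu> ^^ k) h x" for k x
  define D where "D = (\<integral>\<^sup>+x. epowr (h x) p * w x \<partial>\<mu>)"
  have meas[measurable]: "(maximal \<mu> ^^ k) h \<in> borel_measurable \<mu>" for k
    by (induction k) (use maximal_measurable[OF sets] in auto)
  have [measurable]: "b k \<in> borel_measurable \<mu>" for k
    unfolding b_def by measurable
  have b_Suc: "epowr (b (Suc k) x) p = ennreal (c powr p) * (epowr (ennreal (c ^ k)) p * epowr (maximal \<mu> ((maximal \<mu> ^^ k) h) x) p)" for k x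
    using c p by (simp add: b_def epowr_mult epowr_ennreal powr_mult ennreal_mult mult.assoc)
  have b: "(\<integral>\<^sup>+x. epowr (b k x) p * w x \<partial>\<mu>) \<le> ennreal ((1 / 2) ^ k) * D" for k
  proof (induction k)
    case 0
    show ?case by (simp add: b_def D_def)
  next
    case (Suc k)
    have "(\<integral>\<^sup>+x. epowr (b (Suc k) x) p * w x \<partial>\<mu>)
       = ennreal (c powr p) * (epowr (ennreal (c ^ k)) p * (\<integral>\<^sup>+x. epowr (maximal \<mu> ((maximal \<mu> ^^ k) h) x) p * w x \<partial>\<mu>))"
      using maximal_measurable[OF sets, of "(maximal \<mu> ^^ k) h"]
      by (simp add: b_Suc mult.assoc nn_integral_cmult)
    also have "\<dots> \<le> ennreal (c powr p) * (epowr (ennreal (c ^ k)) p * (ennreal N * (\<integral>\<^sup>+x. epowr ((maximal \<mu> ^^ k) h x) p * w x \<partial>\<mu>)))"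
      by (intro mult_left_mono max) auto
    also have "\<dots> = ennreal (c powr p * N) * (epowr (ennreal (c ^ k)) p * (\<integral>\<^sup>+x. epowr ((maximal \<mu> ^^ k) h x) p * w x \<partial>\<mu>))"
      using N by (simp add: ennreal_mult mult_ac)
    also have "epowr (ennreal (c ^ k)) p * (\<integral>\<^sup>+x. epowr ((maximal \<mu> ^^ k) h x) p * w x \<partial>\<mu>)
        = (\<integral>\<^sup>+x. epowr (b k x) p * w x \<partial>\<mu>)"
      using p by (simp add: b_def epowr_mult mult.assoc nn_integral_cmult)
    also have "ennreal (c powr p * N) * \<dots> \<le> ennreal (1 / 2) * (ennreal ((1 / 2) ^ k) * D)"
      unfolding c(2) by (intro mult_left_mono Suc) auto
    also have "ennreal (1 / 2) * (ennreal ((1 / 2) ^ k) * D) = ennreal ((1 / 2) ^ Suc k) * D"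
      unfolding power_Suc by (subst ennreal_mult) (simp_all only: mult.assoc, simp_all)
    finally show ?case .
  qed
  define H\<^sub>0 where "H\<^sub>0 x = (\<Sum>k. ennreal ((1 / 2) ^ k) * b k x)" for x
  have [measurable]: "H\<^sub>0 \<in> borel_measurable \<mu>"
    unfolding H\<^sub>0_def by measurable
  have "(\<integral>\<^sup>+x. epowr (H\<^sub>0 x) p * w x \<partial>\<mu>) \<le> ennreal (2 powr p) * (\<Sum>k. ennreal ((1 / 2) ^ k) * D)"
    unfolding H\<^sub>0_def using p b by (intro nn_integral_suminf_half_le) auto
  also have "\<dots> < top"
    using hfin by (simp add: suminf_half_powers D_def ennreal_mult_less_top)
  finally have H\<^sub>0_fin: "(\<integral>\<^sup>+x. epowr (H\<^sub>0 x) p * w x \<partial>\<mu>) < top" .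
  have h_le: "h x \<le> H\<^sub>0 x" for x
    unfolding H\<^sub>0_def using suminf_ge_term[of "\<lambda>k. ennreal ((1 / 2) ^ k) * b k x" 0] by (simp add: b_def)
  \<comment> \<open>The average of the k-th term over I is at most 2 / c times the term k + 1 at any
    point x of I; the missing term 0 only helps.\<close>
  have avg: "(\<integral>\<^sup>+y\<in>I. H\<^sub>0 y \<partial>\<mu>) \<le> ennreal (2 / c) * H\<^sub>0 x * emeasure \<mu> I" if I: "I \<in> intervals_of \<mu>" "x \<in> I" for I x
  proof -
    have [measurable]: "I \<in> sets \<mu>" using I sets by auto
    obtain m where m: "0 < m" "emeasure \<mu> I = ennreal m"
      using interval_measure[OF I(1)] by auto
    have "(\<integral>\<^sup>+y\<in>I. H\<^sub>0 y \<partial>\<mu>) = (\<Sum>k. \<integral>\<^sup>+y. ennreal ((1 / 2) ^ k) * b k y * indicator I y \<partial>\<mu>)"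
      unfolding H\<^sub>0_def ennreal_suminf_multc[symmetric] by (rule nn_integral_suminf) measurable
    also have "\<dots> \<le> (\<Sum>k. ennreal (2 / c) * (ennreal ((1 / 2) ^ Suc k) * b (Suc k) x) * emeasure \<mu> I)"
    proof (intro suminf_le allI)
      fix k
      let ?J = "\<integral>\<^sup>+y\<in>I. (maximal \<mu> ^^ k) h y \<partial>\<mu>"
      have "?J = ?J / emeasure \<mu> I * emeasure \<mu> I"
        using m ennreal_mult_divide_cancel[of m ?J] by (simp add: mult.commute)
      also have "\<dots> \<le> (maximal \<mu> ^^ Suc k) h x * emeasure \<mu> I"
        using average_le_maximal[of I \<mu> x "(maximal \<mu> ^^ k) h"] I by (auto intro!: mult_right_mono)
      finally have J: "?J \<le> (maximal \<mu> ^^ Suc k) h x * emeasure \<mu> I" .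
      have "(\<integral>\<^sup>+y. ennreal ((1 / 2) ^ k) * b k y * indicator I y \<partial>\<mu>) = ennreal ((1 / 2) ^ k) * (ennreal (c ^ k) * ?J)"
        by (simp add: b_def mult.assoc nn_integral_cmult)
      also have "\<dots> \<le> ennreal ((1 / 2) ^ k) * (ennreal (c ^ k) * ((maximal \<mu> ^^ Suc k) h x * emeasure \<mu> I))"
        by (intro mult_left_mono J) auto
      also have "ennreal ((1 / 2) ^ k) * (ennreal (c ^ k) * ((maximal \<mu> ^^ Suc k) h x * emeasure \<mu> I))
          = ennreal ((1 / 2) ^ k * c ^ k) * ((maximal \<mu> ^^ Suc k) h x * emeasure \<mu> I)"
        using c by (simp add: ennreal_mult mult.assoc)
      also have "(1 / 2) ^ k * c ^ k = 2 / c * ((1 / 2) ^ Suc k * c ^ Suc k)"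
        using c by simp
      also have "ennreal \<dots> * ((maximal \<mu> ^^ Suc k) h x * emeasure \<mu> I)
          = ennreal (2 / c) * (ennreal ((1 / 2) ^ Suc k) * b (Suc k) x) * emeasure \<mu> I"
        unfolding b_def using c by (subst ennreal_mult, simp, simp, subst ennreal_mult) (simp_all only: mult.assoc, simp_all)
      finally show "(\<integral>\<^sup>+y. ennreal ((1 / 2) ^ k) * b k y * indicator I y \<partial>\<mu>)
          \<le> ennreal (2 / c) * (ennreal ((1 / 2) ^ Suc k) * b (Suc k) x) * emeasure \<mu> I" .
    qed auto
    also have "\<dots> = ennreal (2 / c) * (\<Sum>k. ennreal ((1 / 2) ^ Suc k) * b (Suc k) x) * emeasure \<mu> I"
      by simp
    also have "\<dots> \<le> ennreal (2 / c) * H\<^sub>0 x * emeasure \<mu> I"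
      unfolding H\<^sub>0_def
      by (intro mult_left_mono mult_right_mono) (auto simp: suminf_offset[of "\<lambda>k. ennreal ((1 / 2) ^ k) * b k x" 1])
    finally show ?thesis .
  qed
  \<comment> \<open>The series is finite a.e., since its p-th power is integrable against the
    positive w. The value 1 on the exceptional set keeps H real and positive everywhere.\<close>
  define H where "H x = (if H\<^sub>0 x = top then 1 else enn2real (H\<^sub>0 x))" for x
  have [measurable]: "H \<in> borel_measurable \<mu>"
    unfolding H_def by measurable
  have "AE x in \<mu>. epowr (H\<^sub>0 x) p * w x \<noteq> \<infinity>"
    using H\<^sub>0_fin by (intro nn_integral_PInf_AE) auto
  then have AE: "AE x in \<mu>. ennreal (H x) = H\<^sub>0 x"
  proof eventually_elim
    case (elim x)
    then show ?case
      using wpos[of x] p by (cases "H\<^sub>0 x = top") (auto simp: H_def ennreal_top_mult less_top)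
  qed
  have pos: "0 < H x" for x
  proof (cases "H\<^sub>0 x = top")
    case False
    have "1 \<le> H\<^sub>0 x" using h1 h_le by (rule order_trans)
    then have "0 < H\<^sub>0 x" by (metis less_le_trans zero_less_one)
    then show ?thesis using False by (simp add: H_def enn2real_positive_iff less_top)
  qed (simp add: H_def)
  show ?thesis
  proof
    show "A1 H"
      unfolding A1_def
    proof (intro conjI allI exI ballI)
      fix I assume I: "I \<in> intervals_of \<mu>"
      have "(\<integral>\<^sup>+y\<in>I. H y \<partial>\<mu>) = (\<integral>\<^sup>+y\<in>I. H\<^sub>0 y \<partial>\<mu>)"
        using AE by (intro nn_integral_cong_AE) auto
      note * = this
      show "AE x in \<mu>. x \<in> I \<longrightarrow> (\<integral>\<^sup>+y\<in>I. H y \<partial>\<mu>) \<le> ennreal (2 / c * H x) * emeasure \<mu> I"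
        using AE
      proof (elim eventually_mono, intro impI)
        fix x assume "ennreal (H x) = H\<^sub>0 x" "x \<in> I"
        moreover have "ennreal (2 / c * H x) = ennreal (2 / c) * ennreal (H x)"
          using c pos[of x] by (intro ennreal_mult) auto
        ultimately show "(\<integral>\<^sup>+y\<in>I. H y \<partial>\<mu>) \<le> ennreal (2 / c * H x) * emeasure \<mu> I"
          using * avg[OF I] by (simp only:)
      qed
    qed (use c pos in auto)
    show "AE x in \<mu>. h x \<le> ennreal (H x)"
      using AE by eventually_elim (simp add: h_le)
    have "(\<integral>\<^sup>+x. epowr (ennreal (H x)) p * w x \<partial>\<mu>) = (\<integral>\<^sup>+x. epowr (H\<^sub>0 x) p * w x \<partial>\<mu>)"
      using AE by (intro nn_integral_cong_AE) auto
    then show "(\<integral>\<^sup>+x. epowr (ennreal (H x)) p * w x \<partial>\<mu>) < top"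
      using H\<^sub>0_fin by simp
  qed
qed

text \<open>One majorant for all u k at once, at the price of a constant that grows with k: the
  algorithm is run on a weighted sum of them.\<close>

theorem A1_majorant_sequence:
  assumes p: "1 < p" and w: "Ap p w" and [measurable]: "\<And>k. u k \<in> borel_measurable \<mu>"
    and u: "\<And>k. (\<integral>\<^sup>+x. epowr (u k x) p * w x \<partial>\<mu>) \<le> 1"
  obtains H where "A1 H" "\<And>k. AE x in \<mu>. u k x \<le> ennreal (2 * 4 ^ k * H x)"
    "(\<integral>\<^sup>+x. epowr (ennreal (H x)) p * w x \<partial>\<mu>) < top"
proof -
  have [measurable]: "w \<in> borel_measurable \<mu>" and wfin: "(\<integral>\<^sup>+x. w x \<partial>\<mu>) < top"
    using w by (auto simp: Ap_def)
  \<comment> \<open>The function 1 in position 0 ensures h >= 1, hence positivity of the majorant.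
    The factor 2^(-k) makes the integrals summable; h adds another 2^(-(k+1)), so u k enters h with
    coefficient 1 / (2 * 4^k).\<close>
  define v where "v k x = (case k of 0 \<Rightarrow> 1 | Suc k \<Rightarrow> ennreal ((1 / 2) ^ k) * u k x)" for k x
  define h where "h x = (\<Sum>k. ennreal ((1 / 2) ^ k) * v k x)" for x
  have [measurable]: "v k \<in> borel_measurable \<mu>" for k
    unfolding v_def by (cases k) simp_all
  have [measurable]: "h \<in> borel_measurable \<mu>"
    unfolding h_def by measurable
  have v: "(\<integral>\<^sup>+x. epowr (v k x) p * w x \<partial>\<mu>) \<le> (case k of 0 \<Rightarrow> \<integral>\<^sup>+x. w x \<partial>\<mu> | Suc k \<Rightarrow> ennreal ((1 / 2) ^ k))" for k
  proof (cases k)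
    case 0
    then show ?thesis
      using epowr_ennreal[of 1 p] by (simp add: v_def)
  next
    case (Suc j)
    have "((1 / 2) ^ j) powr p \<le> ((1 / 2) ^ j) powr (1::real)"
      using p by (intro powr_mono') (auto simp: power_le_one)
    then have "ennreal (((1 / 2) ^ j) powr p) * (\<integral>\<^sup>+x. epowr (u j x) p * w x \<partial>\<mu>) \<le> ennreal ((1 / 2) ^ j) * 1"
      by (intro mult_mono u ennreal_leI) auto
    then show ?thesis
      using p by (simp add: v_def Suc epowr_mult epowr_ennreal mult.assoc nn_integral_cmult)
  qed
  have "(\<integral>\<^sup>+x. epowr (h x) p * w x \<partial>\<mu>)
      \<le> ennreal (2 powr p) * (\<Sum>k. case k of 0 \<Rightarrow> \<integral>\<^sup>+x. w x \<partial>\<mu> | Suc k \<Rightarrow> ennreal ((1 / 2) ^ k))"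
    unfolding h_def using p v by (intro nn_integral_suminf_half_le) auto
  also have "\<dots> < top"
    using wfin by (simp add: suminf_offset[of "\<lambda>k. case k of 0 \<Rightarrow> _ | Suc k \<Rightarrow> _ k" 1] suminf_half_powers ennreal_mult_less_top)
  finally have hfin: "(\<integral>\<^sup>+x. epowr (h x) p * w x \<partial>\<mu>) < top" .
  have v_le: "ennreal ((1 / 2) ^ k) * v k x \<le> h x" for k x
    unfolding h_def by (rule suminf_ge_term)
  have h1: "1 \<le> h x" for x
    using v_le[of 0 x] by (simp add: v_def)
  have u_le: "u k x \<le> ennreal (2 * 4 ^ k) * h x" for k x
  proof -
    have "ennreal (2 * 4 ^ k) * (ennreal ((1 / 2) ^ Suc k) * v (Suc k) x)
        = ennreal (2 * 4 ^ k * (1 / 2) ^ Suc k * (1 / 2) ^ k) * u k x"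
      by (simp add: v_def mult.assoc[symmetric] del: power_Suc flip: ennreal_mult)
    also have "2 * 4 ^ k * (1 / 2) ^ Suc k * (1 / 2) ^ k = (1 :: real)"
      by (simp add: power_mult_distrib[symmetric] mult.assoc)
    finally show ?thesis
      using mult_left_mono[OF v_le[of "Suc k" x], of "ennreal (2 * 4 ^ k)"] by simp
  qed
  obtain H where H: "A1 H" "AE x in \<mu>. h x \<le> ennreal (H x)"
    "(\<integral>\<^sup>+x. epowr (ennreal (H x)) p * w x \<partial>\<mu>) < top"
    by (rule A1_majorant[OF p w _ h1 hfin]) auto
  have "AE x in \<mu>. u k x \<le> ennreal (2 * 4 ^ k * H x)" for k
    using H(2)
  proof eventually_elim
    case (elim x)
    have "u k x \<le> ennreal (2 * 4 ^ k) * ennreal (H x)"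
      by (intro order_trans[OF u_le] mult_left_mono elim) auto
    then show ?case
      using H(1) by (simp add: A1_def ennreal_mult less_imp_le)
  qed
  with H that show ?thesis by blast
qed

end

subsection \<open>Extrapolation\<close>

text \<open>Above the height y one has g = g^(1-r) g^r with g^(1-r) <= y^(1-r). This trades g for
  g^r pointwise, in place of Hoelder's inequality.\<close>

lemma ennreal_le_add_powr:
  assumes "0 < y" and "1 < r"
  shows "g \<le> ennreal y + ennreal (y powr (1 - r)) * epowr g r"
proof (cases g)
  case (real c)
  show ?thesis
  proof (cases "c \<le> y")
    case True
    then have "g \<le> ennreal y" using real by (simp add: ennreal_leI)
    then show ?thesis by (rule add_increasing2[rotated]) simp
  next
    case False
    have "c = c powr (1 - r) * c powr r"
      using assms False by (simp flip: powr_add)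
    also have "\<dots> \<le> y powr (1 - r) * c powr r"
      using assms False by (intro mult_right_mono powr_mono2') auto
    finally have "g \<le> ennreal (y powr (1 - r)) * epowr g r"
      using real assms by (simp add: epowr_real ennreal_leI flip: ennreal_mult)
    then show ?thesis by (rule add_increasing[rotated]) simp
  qed
next
  case top
  then show ?thesis
    using assms by (simp add: ennreal_mult_top)
qed

text \<open>One of the two terms alone suffices: at the threshold y = x^(p-1) w both terms equal x
  y, and the proof splits there.\<close>

lemma young_weighted:
  fixes x y w p :: real
  assumes "0 < x" "0 < y" "0 < w" "1 < p"
  shows "x * y \<le> x powr p * w + y powr (p / (p - 1)) * w powr (- 1 / (p - 1))"
proof (cases "y \<le> x powr (p - 1) * w")
  case True
  have "x * y \<le> x * (x powr (p - 1) * w)"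
    using True assms by (intro mult_left_mono) auto
  also have "\<dots> = x powr p * w"
    using assms powr_add[of x 1 "p - 1"] by simp
  finally show ?thesis
    by (rule order_trans) simp
next
  case False
  have "x = (x powr (p - 1)) powr (1 / (p - 1))"
    using assms by (simp add: powr_powr)
  also have "\<dots> \<le> (y / w) powr (1 / (p - 1))"
    using False assms by (intro powr_mono2) (auto simp: field_simps)
  finally have "x * y \<le> (y / w) powr (1 / (p - 1)) * y"
    using assms by (intro mult_right_mono) auto
  also have "\<dots> = y powr (1 / (p - 1) + 1) * w powr (- 1 / (p - 1))"
    using assms by (simp add: powr_divide powr_add powr_minus_divide)
  also have "1 / (p - 1) + 1 = p / (p - 1)"
    using assms by (simp add: field_simps)
  finally show ?thesis
    using assms by (simp add: add_increasing)
qed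

text \<open>The root of order p of the supremum bounds every truncation, hence g; this avoids a
  continuity argument for the power at infinity.\<close>

lemma SUP_epowr_inf_of_nat:
  assumes "0 < p"
  shows "(SUP n. epowr (inf g (of_nat n)) p) = epowr g p"
proof (rule antisym)
  show "(SUP n. epowr (inf g (of_nat n)) p) \<le> epowr g p"
    using assms by (intro SUP_least epowr_mono) auto
  let ?S = "SUP n. epowr (inf g (of_nat n)) p"
  have "inf g (of_nat n) \<le> epowr ?S (1 / p)" for n
  proof -
    have "epowr (epowr (inf g (of_nat n)) p) (1 / p) \<le> epowr ?S (1 / p)"
      using assms by (intro epowr_mono SUP_upper) auto
    then show ?thesis using assms by (simp add: epowr_epowr)
  qed
  then have "(SUP n. inf g (of_nat n)) \<le> epowr ?S (1 / p)"
    by (intro SUP_least)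
  then have "g \<le> epowr ?S (1 / p)"
    by (simp add: ennreal_SUP_of_nat_eq_top flip: inf_SUP)
  then have "epowr g p \<le> epowr (epowr ?S (1 / p)) p"
    using assms by (intro epowr_mono)
  then show "epowr g p \<le> ?S"
    using assms by (simp add: epowr_epowr)
qed

context interval_space
begin

section \<open>A_1 functions and the A_r weight formed from two of them\<close>

text \<open>An infinite integral would force an infinite right side of the A_1 inequality at almost
  every point of I, while H is real and I has positive finite measure.\<close>

lemma A1_integrable:
  assumes "A1 H" and I: "I \<in> intervals_of \<mu>"
  shows "(\<integral>\<^sup>+x\<in>I. H x \<partial>\<mu>) < top"
proof (rule ccontr)
  assume inf: "\<not> ?thesis"
  obtain m where m: "0 < m" "emeasure \<mu> I = ennreal m"
    using interval_measure[OF I] by auto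
  have Is: "I \<in> sets \<mu>" using I sets by auto
  obtain A :: real where "AE x in \<mu>. x \<in> I \<longrightarrow> (\<integral>\<^sup>+y\<in>I. H y \<partial>\<mu>) \<le> A * H x * emeasure \<mu> I"
    using assms by (auto simp: A1_def)
  then have "AE x in \<mu>. x \<notin> I"
    by eventually_elim (use inf m in \<open>auto simp: top_unique ennreal_mult_eq_top_iff simp flip: less_top\<close>)
  then have "emeasure \<mu> I = 0"
    using AE_iff_null_sets[OF Is] by (simp add: null_sets_def)
  then show False using m by simp
qed

lemma A1_interval_integral:
  assumes "A1 H" and I: "I \<in> intervals_of \<mu>"
  shows "\<exists>v>0. (\<integral>\<^sup>+x\<in>I. H x \<partial>\<mu>) = ennreal v"
proof -
  have "(\<integral>\<^sup>+x\<in>I. H x \<partial>\<mu>) \<noteq> 0"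
    using assms by (intro interval_integral_nonzero) (auto simp: A1_def)
  then show ?thesis
    using A1_integrable[OF assms] by (cases "\<integral>\<^sup>+x\<in>I. H x \<partial>\<mu>") (auto simp: less_le)
qed

text \<open>The A_1 condition read as an essential lower bound by the average, the form that
  controls negative powers of H.\<close>

lemma A1_lower_bound:
  assumes "A1 H"
  obtains A :: real where "0 < A" "\<And>I m v. I \<in> intervals_of \<mu> \<Longrightarrow> emeasure \<mu> I = ennreal m \<Longrightarrow> 0 < m \<Longrightarrow>
    (\<integral>\<^sup>+x\<in>I. H x \<partial>\<mu>) = ennreal v \<Longrightarrow> AE x in \<mu>. x \<in> I \<longrightarrow> v / (A * m) \<le> H x"
proof -
  obtain A :: real where A: "0 < A" and le: "\<And>I. I \<in> intervals_of \<mu> \<Longrightarrow>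
      AE x in \<mu>. x \<in> I \<longrightarrow> (\<integral>\<^sup>+y\<in>I. H y \<partial>\<mu>) \<le> A * H x * emeasure \<mu> I"
    and pos: "\<And>x. 0 < H x"
    using assms by (auto simp: A1_def)
  have "AE x in \<mu>. x \<in> I \<longrightarrow> v / (A * m) \<le> H x"
    if "I \<in> intervals_of \<mu>" "emeasure \<mu> I = ennreal m" "0 < m" "(\<integral>\<^sup>+x\<in>I. H x \<partial>\<mu>) = ennreal v" for I m v
    using le[OF that(1)]
  proof (elim eventually_mono, intro impI)
    fix x assume "x \<in> I \<longrightarrow> (\<integral>\<^sup>+y\<in>I. H y \<partial>\<mu>) \<le> A * H x * emeasure \<mu> I" "x \<in> I"
    then have "ennreal v \<le> ennreal (A * H x * m)"
      using that A pos[of x] by (simp add: ennreal_mult)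
    then have "v \<le> A * H x * m"
      using A pos[of x] that by (simp add: ennreal_le_iff)
    then show "v / (A * m) \<le> H x"
      using A that by (simp add: field_simps)
  qed
  with A that show ?thesis by blast
qed

text \<open>The easy half of Jones' factorization. The dual weight is \<open>H\<^sub>1\<close> times
  a negative power of \<open>H\<^sub>2\<close>, symmetric to the weight itself. On an interval each
  negative power is replaced by that power of the average, and the averages cancel in the A_r
  product.\<close>

lemma A1_factorization:
  assumes r: "1 < r" and H1: "A1 H\<^sub>1" and H2: "A1 H\<^sub>2" and space: "space \<mu> \<in> intervals_of \<mu>"
  shows "Ap r (\<lambda>x. H\<^sub>2 x * H\<^sub>1 x powr (1 - r))"
proof -
  let ?W = "\<lambda>x. H\<^sub>2 x * H\<^sub>1 x powr (1 - r)"
  have [measurable]: "H\<^sub>1 \<in> borel_measurable \<mu>" "H\<^sub>2 \<in> borel_measurable \<mu>"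
    and pos: "\<And>x. 0 < H\<^sub>1 x" "\<And>x. 0 < H\<^sub>2 x"
    using H1 H2 by (auto simp: A1_def)
  have dual: "dual_weight r ?W x = H\<^sub>2 x powr (- 1 / (r - 1)) * H\<^sub>1 x" for x
  proof -
    have "(1 - r) * (- 1 / (r - 1)) = 1" using r by (simp add: field_simps)
    then show ?thesis
      using pos[of x] unfolding dual_weight_def by (simp only: powr_mult powr_powr) simp
  qed
  obtain A\<^sub>1 where A1: "0 < A\<^sub>1" and low1: "\<And>I m v. I \<in> intervals_of \<mu> \<Longrightarrow> emeasure \<mu> I = ennreal m \<Longrightarrow> 0 < m \<Longrightarrow>
    (\<integral>\<^sup>+x\<in>I. H\<^sub>1 x \<partial>\<mu>) = ennreal v \<Longrightarrow> AE x in \<mu>. x \<in> I \<longrightarrow> v / (A\<^sub>1 * m) \<le> H\<^sub>1 x"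
    by (rule A1_lower_bound[OF H1]) (rule that)
  obtain A\<^sub>2 where A2: "0 < A\<^sub>2" and low2: "\<And>I m v. I \<in> intervals_of \<mu> \<Longrightarrow> emeasure \<mu> I = ennreal m \<Longrightarrow> 0 < m \<Longrightarrow>
    (\<integral>\<^sup>+x\<in>I. H\<^sub>2 x \<partial>\<mu>) = ennreal v \<Longrightarrow> AE x in \<mu>. x \<in> I \<longrightarrow> v / (A\<^sub>2 * m) \<le> H\<^sub>2 x"
    by (rule A1_lower_bound[OF H2]) (rule that)
  have Wpos: "0 < ?W x" for x
    using pos[of x] by simp
  have bounds: "\<exists>a b m. 0 < m \<and> emeasure \<mu> I = ennreal m \<and> 0 \<le> a \<and> 0 \<le> b \<and> (\<integral>\<^sup>+x\<in>I. ?W x \<partial>\<mu>) \<le> ennreal a \<and>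
      (\<integral>\<^sup>+x\<in>I. dual_weight r ?W x \<partial>\<mu>) \<le> ennreal b \<and> a * b powr (r - 1) = A\<^sub>1 powr (r - 1) * A\<^sub>2 * m powr r"
    if I: "I \<in> intervals_of \<mu>" for I
  proof -
    have [measurable]: "I \<in> sets \<mu>" using I sets by auto
    obtain m u v where m: "0 < m" "emeasure \<mu> I = ennreal m"
      and u: "0 < u" "(\<integral>\<^sup>+x\<in>I. H\<^sub>1 x \<partial>\<mu>) = ennreal u"
      and v: "0 < v" "(\<integral>\<^sup>+x\<in>I. H\<^sub>2 x \<partial>\<mu>) = ennreal v"
      using interval_measure[OF I] A1_interval_integral[OF H1 I] A1_interval_integral[OF H2 I] by auto
    let ?a = "(u / (A\<^sub>1 * m)) powr (1 - r)" and ?b = "(v / (A\<^sub>2 * m)) powr (- 1 / (r - 1))"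
    have "(\<integral>\<^sup>+x\<in>I. ?W x \<partial>\<mu>) \<le> (\<integral>\<^sup>+x. ennreal ?a * (ennreal (H\<^sub>2 x) * indicator I x) \<partial>\<mu>)"
    proof (rule nn_integral_mono_AE, use low1[OF I m(2,1) u(2)] in eventually_elim)
      fix x assume "x \<in> I \<longrightarrow> u / (A\<^sub>1 * m) \<le> H\<^sub>1 x"
      then show "ennreal (?W x) * indicator I x \<le> ennreal ?a * (ennreal (H\<^sub>2 x) * indicator I x)"
        using A1 m u r pos[of x]
        by (auto simp: mult.commute indicator_def intro!: ennreal_leI mult_left_mono powr_mono2' simp flip: ennreal_mult)
    qed
    then have 1: "(\<integral>\<^sup>+x\<in>I. ?W x \<partial>\<mu>) \<le> ennreal (?a * v)"
      using v by (simp add: nn_integral_cmult ennreal_mult)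
    have "(\<integral>\<^sup>+x\<in>I. dual_weight r ?W x \<partial>\<mu>) \<le> (\<integral>\<^sup>+x. ennreal ?b * (ennreal (H\<^sub>1 x) * indicator I x) \<partial>\<mu>)"
    proof (rule nn_integral_mono_AE, use low2[OF I m(2,1) v(2)] in eventually_elim)
      fix x assume "x \<in> I \<longrightarrow> v / (A\<^sub>2 * m) \<le> H\<^sub>2 x"
      then show "ennreal (dual_weight r ?W x) * indicator I x \<le> ennreal ?b * (ennreal (H\<^sub>1 x) * indicator I x)"
        using A2 m v r pos[of x] unfolding dual
        by (auto simp: indicator_def intro!: ennreal_leI mult_right_mono powr_mono2' simp flip: ennreal_mult)
    qed
    then have 2: "(\<integral>\<^sup>+x\<in>I. dual_weight r ?W x \<partial>\<mu>) \<le> ennreal (?b * u)"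
      using u by (simp add: nn_integral_cmult ennreal_mult)
    \<comment> \<open>This power cancels the factor v; below, the power of u inside ?a cancels
      \<open>u powr (r - 1)\<close>, and only a power of m remains.\<close>
    have "?b powr (r - 1) = A\<^sub>2 * m / v"
    proof -
      have "?b powr (r - 1) = (v / (A\<^sub>2 * m)) powr (- 1)"
        using r unfolding powr_powr by simp
      then show ?thesis
        using A2 m v by (simp add: powr_minus field_simps)
    qed
    then have ab: "?a * v * (?b * u) powr (r - 1) = ?a * u powr (r - 1) * A\<^sub>2 * m"
      using A2 m u v by (simp add: powr_mult)
    have a: "?a = u powr (1 - r) * A\<^sub>1 powr (r - 1) * m powr (r - 1)"
      using A1 m u powr_minus[of A\<^sub>1 "r - 1"] powr_minus[of m "r - 1"]
      by (simp add: powr_divide powr_mult field_simps)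
    have "?a * u powr (r - 1) * A\<^sub>2 * m = A\<^sub>1 powr (r - 1) * A\<^sub>2 * (m powr (r - 1) * m) * (u powr (1 - r) * u powr (r - 1))"
      unfolding a by (simp add: mult_ac)
    also have "u powr (1 - r) * u powr (r - 1) = 1"
      using u by (simp flip: powr_add)
    also have "m powr (r - 1) * m = m powr r"
      using m powr_add[of m "r - 1" 1] by simp
    finally have "?a * u powr (r - 1) * A\<^sub>2 * m = A\<^sub>1 powr (r - 1) * A\<^sub>2 * m powr r" by (simp only: mult_1_right)
    with ab have "?a * v * (?b * u) powr (r - 1) = A\<^sub>1 powr (r - 1) * A\<^sub>2 * m powr r" by (simp only:)
    moreover have "0 \<le> ?a * v" "0 \<le> ?b * u"
      using u v by auto
    ultimately show ?thesis
      using 1 2 m by blast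
  qed
  \<comment> \<open>The whole space is an interval, so the same bounds give integrability of the
    weight and its dual.\<close>
  obtain a b where ab: "(\<integral>\<^sup>+x\<in>space \<mu>. ?W x \<partial>\<mu>) \<le> ennreal a" "(\<integral>\<^sup>+x\<in>space \<mu>. dual_weight r ?W x \<partial>\<mu>) \<le> ennreal b"
    using bounds[OF space] by (elim exE conjE) (rule that)
  have whole: "(\<integral>\<^sup>+x\<in>space \<mu>. k x \<partial>\<mu>) = (\<integral>\<^sup>+x. k x \<partial>\<mu>)" for k
    by (intro nn_integral_cong) simp
  have fin: "(\<integral>\<^sup>+x. ?W x \<partial>\<mu>) < top" "(\<integral>\<^sup>+x. dual_weight r ?W x \<partial>\<mu>) < top"
    using le_less_trans[OF ab(1) ennreal_less_top] le_less_trans[OF ab(2) ennreal_less_top]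
    unfolding whole .
  show ?thesis
    unfolding Ap_def
  proof (intro conjI fin allI exI[of _ "A\<^sub>1 powr (r - 1) * A\<^sub>2"] ballI)
    fix I assume "I \<in> intervals_of \<mu>"
    then obtain a b m where abm: "0 < m" "emeasure \<mu> I = ennreal m" "0 \<le> a" "0 \<le> b" "(\<integral>\<^sup>+x\<in>I. ?W x \<partial>\<mu>) \<le> ennreal a"
      "(\<integral>\<^sup>+x\<in>I. dual_weight r ?W x \<partial>\<mu>) \<le> ennreal b" "a * b powr (r - 1) = A\<^sub>1 powr (r - 1) * A\<^sub>2 * m powr r"
      using bounds by blast
    have "(\<integral>\<^sup>+x\<in>I. ?W x \<partial>\<mu>) * epowr (\<integral>\<^sup>+x\<in>I. dual_weight r ?W x \<partial>\<mu>) (r - 1) \<le> ennreal a * epowr (ennreal b) (r - 1)"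
      using r abm by (intro mult_mono epowr_mono) auto
    also have "\<dots> = ennreal (A\<^sub>1 powr (r - 1) * A\<^sub>2 * m powr r)"
      using r abm by (simp add: epowr_real flip: ennreal_mult)
    also have "\<dots> = ennreal (A\<^sub>1 powr (r - 1) * A\<^sub>2) * ennreal (m powr r)"
      using A2 by (intro ennreal_mult) auto
    also have "ennreal (m powr r) = epowr (emeasure \<mu> I) r"
      using r abm by (simp add: epowr_real)
    finally show "(\<integral>\<^sup>+x\<in>I. ?W x \<partial>\<mu>) * epowr (\<integral>\<^sup>+x\<in>I. dual_weight r ?W x \<partial>\<mu>) (r - 1)
        \<le> ennreal (A\<^sub>1 powr (r - 1) * A\<^sub>2) * epowr (emeasure \<mu> I) r" .
  qed (use A1 A2 Wpos in auto)
qed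

section \<open>Duality and the normalization of violating pairs\<close>

text \<open>The converse of Hoelder's inequality, also when the norm of g is infinite. Truncating g
  at a large n gives a function h of finite norm, since w is integrable, whose integral still
  exceeds d; then u is a multiple of h^(p-1) w, the case of equality.\<close>

lemma norming_function:
  assumes p: "1 < p" and w[measurable]: "w \<in> borel_measurable \<mu>" and wpos: "\<And>x. 0 < w x"
    and wfin: "(\<integral>\<^sup>+x. w x \<partial>\<mu>) < top" and g[measurable]: "g \<in> borel_measurable \<mu>"
    and d: "0 < d" "ennreal d < (\<integral>\<^sup>+x. epowr (g x) p * w x \<partial>\<mu>)"
  shows "\<exists>u\<in>borel_measurable \<mu>. (\<integral>\<^sup>+x. epowr (u x) (p / (p - 1)) * dual_weight p w x \<partial>\<mu>) \<le> 1 \<and>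
    ennreal (d powr (1 / p)) \<le> (\<integral>\<^sup>+x. g x * u x \<partial>\<mu>)"
proof -
  let ?q = "p / (p - 1)"
  have "(\<integral>\<^sup>+x. epowr (g x) p * w x \<partial>\<mu>) = (\<integral>\<^sup>+x. (SUP n. epowr (inf (g x) (of_nat n)) p * w x) \<partial>\<mu>)"
    using p by (simp add: SUP_epowr_inf_of_nat flip: SUP_mult_right_ennreal)
  also have "\<dots> = (SUP n. \<integral>\<^sup>+x. epowr (inf (g x) (of_nat n)) p * w x \<partial>\<mu>)"
    using p by (intro nn_integral_monotone_convergence_SUP)
      (auto simp: incseq_def le_fun_def intro!: mult_right_mono epowr_mono inf_mono)
  finally obtain n where n: "ennreal d < (\<integral>\<^sup>+x. epowr (inf (g x) (of_nat n)) p * w x \<partial>\<mu>)"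
    using d(2) by (auto simp: less_SUP_iff)
  define h where "h x = inf (g x) (of_nat n)" for x
  have [measurable]: "h \<in> borel_measurable \<mu>"
    unfolding h_def by measurable
  have "(\<integral>\<^sup>+x. epowr (h x) p * w x \<partial>\<mu>) \<le> (\<integral>\<^sup>+x. ennreal (real n powr p) * w x \<partial>\<mu>)"
  proof (intro nn_integral_mono mult_right_mono)
    show "epowr (h x) p \<le> ennreal (real n powr p)" for x
      using epowr_mono[of p "h x" "ennreal (real n)"] p by (simp add: h_def epowr_real ennreal_of_nat_eq_real_of_nat)
  qed auto
  also have "\<dots> < top"
    using wfin by (simp add: nn_integral_cmult ennreal_mult_less_top)
  finally obtain b where b: "0 \<le> b" "(\<integral>\<^sup>+x. epowr (h x) p * w x \<partial>\<mu>) = ennreal b"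
    by (cases "\<integral>\<^sup>+x. epowr (h x) p * w x \<partial>\<mu>") auto
  then have db: "d < b"
    using n d(1) unfolding h_def[symmetric] by (simp add: ennreal_less_iff)
  \<comment> \<open>Normalization: the integral of u^p' against the dual weight is c^p' b = 1, and
    then h is paired with u to c b = b^(1 - 1/p') = b^(1/p).\<close>
  define c where "c = b powr (- 1 / ?q)"
  have c: "0 < c" "c powr ?q * b = 1" "c * b = b powr (1 / p)"
  proof -
    show "0 < c" using db d(1) by (simp add: c_def)
    have "- 1 / ?q * ?q = - 1"
      using p by (simp add: field_simps)
    then have "c powr ?q = b powr (- 1)"
      unfolding c_def powr_powr by (simp only:)
    then show "c powr ?q * b = 1"
      using db d(1) by (simp add: powr_minus)
    have "- 1 / ?q + 1 = 1 / p"
      using p by (simp add: field_simps)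
    then show "c * b = b powr (1 / p)"
      using db d(1) powr_add[of b "- 1 / ?q" 1] by (simp add: c_def)
  qed
  define u where "u x = epowr (h x) (p - 1) * ennreal (c * w x)" for x
  have u: "u \<in> borel_measurable \<mu>"
    unfolding u_def by measurable
  have "epowr (u x) ?q * dual_weight p w x = ennreal (c powr ?q) * (epowr (h x) p * w x)" for x
  proof -
    have "w x powr ?q * dual_weight p w x = w x powr (?q + - 1 / (p - 1))"
      by (simp add: dual_weight_def flip: powr_add)
    also have "?q + - 1 / (p - 1) = 1"
      using p by (simp flip: diff_divide_distrib)
    finally have "w x powr ?q * dual_weight p w x = w x"
      using wpos[of x] by simp
    then have "(c * w x) powr ?q * dual_weight p w x = c powr ?q * w x"
      using c(1) wpos[of x] by (simp add: powr_mult)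
    then have "ennreal ((c * w x) powr ?q) * ennreal (dual_weight p w x) = ennreal (c powr ?q) * ennreal (w x)"
      using wpos[of x] dual_weight_pos[of w x p] by (simp flip: ennreal_mult)
    then show ?thesis
      using c(1) wpos[of x] p
      by (simp add: u_def epowr_mult epowr_epowr epowr_ennreal mult.assoc mult.left_commute)
  qed
  then have "(\<integral>\<^sup>+x. epowr (u x) ?q * dual_weight p w x \<partial>\<mu>) = ennreal (c powr ?q * b)"
    by (simp add: nn_integral_cmult b ennreal_mult)
  then have 1: "(\<integral>\<^sup>+x. epowr (u x) ?q * dual_weight p w x \<partial>\<mu>) \<le> 1"
    by (simp add: c)
  have "ennreal (d powr (1 / p)) \<le> ennreal (c * b)"
    unfolding c(3) using db d(1) p by (intro ennreal_leI powr_mono2) auto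
  also have "\<dots> = (\<integral>\<^sup>+x. ennreal c * (epowr (h x) p * w x) \<partial>\<mu>)"
    using c(1) b by (simp add: nn_integral_cmult ennreal_mult)
  also have "\<dots> \<le> (\<integral>\<^sup>+x. g x * u x \<partial>\<mu>)"
  proof (intro nn_integral_mono)
    fix x
    have "epowr (h x) p = h x * epowr (h x) (p - 1)"
      using epowr_add[of 1 "p - 1" "h x"] p by simp
    then have "ennreal c * (epowr (h x) p * w x) = h x * u x"
      using c(1) wpos[of x] by (simp add: u_def ennreal_mult mult_ac)
    also have "\<dots> \<le> g x * u x"
      by (intro mult_right_mono) (auto simp: h_def)
    finally show "ennreal c * (epowr (h x) p * w x) \<le> g x * u x" .
  qed
  finally show ?thesis
    using 1 u by blast
qed

end

context interval_space
begin

lemma violating_pair: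
  assumes p: "1 < p" and w: "w \<in> borel_measurable \<mu>" "\<And>x. 0 < w x" "(\<integral>\<^sup>+x. w x \<partial>\<mu>) < top"
    and meas[measurable]: "f \<in> borel_measurable \<mu>" "g \<in> borel_measurable \<mu>" and N: "0 < N"
    and gt: "ennreal (N powr p) * (\<integral>\<^sup>+x. epowr (f x) p * w x \<partial>\<mu>) < (\<integral>\<^sup>+x. epowr (g x) p * w x \<partial>\<mu>)"
  shows "\<exists>(a::real) u v. 0 < a \<and> u \<in> borel_measurable \<mu> \<and> v \<in> borel_measurable \<mu> \<and>
    (\<integral>\<^sup>+x. epowr (u x) p * w x \<partial>\<mu>) \<le> 1 \<and> (\<forall>x. f x = ennreal a * u x) \<and>
    (\<integral>\<^sup>+x. epowr (v x) (p / (p - 1)) * dual_weight p w x \<partial>\<mu>) \<le> 1 \<and>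
    ennreal (N * a) \<le> (\<integral>\<^sup>+x. g x * v x \<partial>\<mu>)"
proof -
  note w(1)[measurable]
  \<comment> \<open>A level strictly between both sides is positive and finite, so it can set the
    scale even if the norm of f is 0 or that of g is infinite.\<close>
  obtain e where e: "ennreal (N powr p) * (\<integral>\<^sup>+x. epowr (f x) p * w x \<partial>\<mu>) < e" "e < (\<integral>\<^sup>+x. epowr (g x) p * w x \<partial>\<mu>)"
    using dense[OF gt] by blast
  have "0 < e" "e < top"
    using le_less_trans[OF zero_le e(1)] less_le_trans[OF e(2) top_greatest] .
  then obtain d where d: "e = ennreal d" "0 < d"
    by (cases e) auto
  \<comment> \<open>Dividing f by a multiplies its integral by N^p / d, so the result is at most e /
    d = 1, while the pairing of g with v is at least d^(1/p) = N a.\<close>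
  define a where "a = d powr (1 / p) / N"
  have a: "0 < a" "N * a = d powr (1 / p)"
    using N d by (simp_all add: a_def)
  have ap: "(1 / a) powr p = N powr p / d"
    using N d p by (simp add: a_def powr_divide powr_powr)
  obtain v where v: "v \<in> borel_measurable \<mu>" "(\<integral>\<^sup>+x. epowr (v x) (p / (p - 1)) * dual_weight p w x \<partial>\<mu>) \<le> 1"
    "ennreal (d powr (1 / p)) \<le> (\<integral>\<^sup>+x. g x * v x \<partial>\<mu>)"
    using norming_function[OF p w meas(2) d(2)] e(2) d(1) by blast
  define u where "u x = ennreal (1 / a) * f x" for x
  have "(\<integral>\<^sup>+x. epowr (u x) p * w x \<partial>\<mu>) = ennreal ((1 / a) powr p) * (\<integral>\<^sup>+x. epowr (f x) p * w x \<partial>\<mu>)"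
  proof -
    have "epowr (u x) p * w x = ennreal ((1 / a) powr p) * (epowr (f x) p * w x)" for x
      using a(1) p by (simp only: u_def epowr_mult epowr_ennreal mult.assoc zero_less_divide_1_iff order_less_trans[OF zero_less_one])
    then show ?thesis
      by (simp only: nn_integral_cmult) (rule nn_integral_cmult, measurable)
  qed
  also have "\<dots> = ennreal (1 / d) * (ennreal (N powr p) * (\<integral>\<^sup>+x. epowr (f x) p * w x \<partial>\<mu>))"
    using d unfolding ap mult.assoc[symmetric] by (subst ennreal_mult[symmetric]) auto
  also have "\<dots> \<le> ennreal (1 / d) * ennreal d"
    using e(1) d(1) by (intro mult_left_mono) auto
  also have "\<dots> = 1"
    using d by (subst ennreal_mult[symmetric]) auto
  finally have "(\<integral>\<^sup>+x. epowr (u x) p * w x \<partial>\<mu>) \<le> 1" .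
  moreover have "f x = ennreal a * u x" for x
    using a unfolding u_def mult.assoc[symmetric] by (subst ennreal_mult[symmetric]) auto
  moreover have "u \<in> borel_measurable \<mu>"
    unfolding u_def by measurable
  ultimately show ?thesis
    using a v by (intro exI[of _ a] exI[of _ u] exI[of _ v]) auto
qed

text \<open>The constants in the hypothesis may depend on the weight in an arbitrary way, so a bound that
  fails for a weight in \<open>A\<^sub>p\<close> is refuted by a single weight in \<open>A\<^sub>r\<close>, which is built from a whole
  sequence of pairs that violate the bound more and more.\<close>

theorem extrapolation:
  assumes r: "1 < r" and p: "1 < p" and w: "Ap p w" and space: "space \<mu> \<in> intervals_of \<mu>"
    and meas: "\<And>f g. (f, g) \<in> F \<Longrightarrow> f \<in> borel_measurable \<mu> \<and> g \<in> borel_measurable \<mu>"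
    and hyp: "\<And>W. Ap r W \<Longrightarrow> \<exists>C>0. \<forall>(f, g)\<in>F.
       (\<integral>\<^sup>+x. epowr (g x) r * ennreal (W x) \<partial>\<mu>) \<le> ennreal C * (\<integral>\<^sup>+x. epowr (f x) r * ennreal (W x) \<partial>\<mu>)"
  shows "\<exists>C>0. \<forall>(f, g)\<in>F.
       (\<integral>\<^sup>+x. epowr (g x) p * ennreal (w x) \<partial>\<mu>) \<le> ennreal C * (\<integral>\<^sup>+x. epowr (f x) p * ennreal (w x) \<partial>\<mu>)"
proof (rule ccontr)
  assume neg: "\<not> ?thesis"
  let ?\<sigma> = "dual_weight p w" and ?q = "p / (p - 1)"
  have q: "1 < ?q" using p by simp
  have wm[measurable]: "w \<in> borel_measurable \<mu>" and wpos: "\<And>x. 0 < w x"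
    and wfin: "(\<integral>\<^sup>+x. w x \<partial>\<mu>) < top"
    using w by (auto simp: Ap_def)
  \<comment> \<open>The power 16^k absorbs the losses 4^k of the two majorants, for u k and for v k;
    the factor k + 1 is left over and gives the contradiction.\<close>
  define N where "N k = 16 ^ k * real (Suc k)" for k
  have N: "0 < N k" for k
    by (simp add: N_def)
  define bad where "bad k f g a u v \<longleftrightarrow> (f, g) \<in> F \<and> 0 < a \<and> u \<in> borel_measurable \<mu> \<and> v \<in> borel_measurable \<mu> \<and>
    (\<integral>\<^sup>+x. epowr (u x) p * w x \<partial>\<mu>) \<le> 1 \<and> (\<forall>x. f x = ennreal a * u x) \<and>
    (\<integral>\<^sup>+x. epowr (v x) ?q * ?\<sigma> x \<partial>\<mu>) \<le> 1 \<and> ennreal (N k * a) \<le> (\<integral>\<^sup>+x. g x * v x \<partial>\<mu>)" for k f g a u v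
  have "\<exists>f g a u v. bad k f g a u v" for k
  proof -
    have "0 < N k powr p" using N[of k] by simp
    then have "\<not> (\<forall>(f, g)\<in>F. (\<integral>\<^sup>+x. epowr (g x) p * w x \<partial>\<mu>) \<le> ennreal (N k powr p) * (\<integral>\<^sup>+x. epowr (f x) p * w x \<partial>\<mu>))"
      using neg by blast
    then obtain f g where fg: "(f, g) \<in> F"
      and gt: "ennreal (N k powr p) * (\<integral>\<^sup>+x. epowr (f x) p * w x \<partial>\<mu>) < (\<integral>\<^sup>+x. epowr (g x) p * w x \<partial>\<mu>)"
      by (auto simp: not_le)
    show ?thesis
      using violating_pair[OF p wm wpos wfin _ _ N gt] meas[OF fg] fg unfolding bad_def by blast
  qed
  then have "\<forall>k. \<exists>f g a u v. bad k f g a u v" by blast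
  then obtain f g a u v where bad: "bad k (f k) (g k) (a k) (u k) (v k)" for k
    unfolding choice_iff by blast
  have FG: "\<And>k. (f k, g k) \<in> F" and a: "\<And>k. 0 < (a k :: real)"
    and um[measurable]: "\<And>k. u k \<in> borel_measurable \<mu>" and vm[measurable]: "\<And>k. v k \<in> borel_measurable \<mu>"
    and u: "\<And>k. (\<integral>\<^sup>+x. epowr (u k x) p * w x \<partial>\<mu>) \<le> 1" "\<And>k x. f k x = ennreal (a k) * u k x"
    and v: "\<And>k. (\<integral>\<^sup>+x. epowr (v k x) ?q * ?\<sigma> x \<partial>\<mu>) \<le> 1"
      "\<And>k. ennreal (N k * a k) \<le> (\<integral>\<^sup>+x. g k x * v k x \<partial>\<mu>)"
    using bad unfolding bad_def by blast+
  have [measurable]: "f k \<in> borel_measurable \<mu>" "g k \<in> borel_measurable \<mu>" for k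
    using meas[OF FG] by auto
  obtain H\<^sub>1 where H1: "A1 H\<^sub>1" and u_le: "\<And>k. AE x in \<mu>. u k x \<le> ennreal (2 * 4 ^ k * H\<^sub>1 x)"
    and H1_fin: "(\<integral>\<^sup>+x. epowr (ennreal (H\<^sub>1 x)) p * w x \<partial>\<mu>) < top"
    by (rule A1_majorant_sequence[OF p w um u(1)]) (rule that)
  obtain H\<^sub>2 where H2: "A1 H\<^sub>2" and v_le: "\<And>k. AE x in \<mu>. v k x \<le> ennreal (2 * 4 ^ k * H\<^sub>2 x)"
    and H2_fin: "(\<integral>\<^sup>+x. epowr (ennreal (H\<^sub>2 x)) ?q * ?\<sigma> x \<partial>\<mu>) < top"
    by (rule A1_majorant_sequence[OF q Ap_dual[OF p w] vm v(1)]) (rule that)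
  have [measurable]: "H\<^sub>1 \<in> borel_measurable \<mu>" "H\<^sub>2 \<in> borel_measurable \<mu>"
    and pos: "\<And>x. 0 < H\<^sub>1 x" "\<And>x. 0 < H\<^sub>2 x"
    using H1 H2 by (auto simp: A1_def)
  have "(\<integral>\<^sup>+x. ennreal (H\<^sub>1 x * H\<^sub>2 x) \<partial>\<mu>)
      \<le> (\<integral>\<^sup>+x. epowr (ennreal (H\<^sub>1 x)) p * w x + epowr (ennreal (H\<^sub>2 x)) ?q * ?\<sigma> x \<partial>\<mu>)"
  proof (intro nn_integral_mono)
    fix x
    show "ennreal (H\<^sub>1 x * H\<^sub>2 x) \<le> epowr (ennreal (H\<^sub>1 x)) p * w x + epowr (ennreal (H\<^sub>2 x)) ?q * ?\<sigma> x"
      using ennreal_leI[OF young_weighted[OF pos(1)[of x] pos(2)[of x] wpos[of x] p]] pos[of x] wpos[of x]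
      by (simp add: epowr_ennreal dual_weight_def ennreal_mult ennreal_plus)
  qed
  also have "\<dots> < top"
    using H1_fin H2_fin by (simp add: nn_integral_add)
  \<comment> \<open>Apart from C, the integral Q is the only quantity in the final bound, and
    neither depends on k.\<close>
  finally obtain Q where Q: "0 \<le> Q" "(\<integral>\<^sup>+x. ennreal (H\<^sub>1 x * H\<^sub>2 x) \<partial>\<mu>) = ennreal Q"
    by (cases "\<integral>\<^sup>+x. ennreal (H\<^sub>1 x * H\<^sub>2 x) \<partial>\<mu>") auto
  \<comment> \<open>The exponent is dictated by \<open>H\<^sub>1\<close>^r W =
    \<open>H\<^sub>1\<close> \<open>H\<^sub>2\<close>, so that the hypothesis for W bounds the
    integral of (f k)^r W by a multiple of Q.\<close>
  define W where "W x = H\<^sub>2 x * H\<^sub>1 x powr (1 - r)" for x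
  have [measurable]: "W \<in> borel_measurable \<mu>"
    unfolding W_def by measurable
  have "Ap r W"
    using A1_factorization[OF r H1 H2 space] by (simp add: W_def[abs_def])
  from hyp[OF this] obtain C where C_pos: "0 < C"
    and C_all: "\<forall>(f, g)\<in>F. (\<integral>\<^sup>+x. epowr (g x) r * W x \<partial>\<mu>) \<le> ennreal C * (\<integral>\<^sup>+x. epowr (f x) r * W x \<partial>\<mu>)"
    by blast
  have C: "(\<integral>\<^sup>+x. epowr (g k x) r * W x \<partial>\<mu>) \<le> ennreal C * (\<integral>\<^sup>+x. epowr (f k x) r * W x \<partial>\<mu>)" for k
    using bspec[OF C_all FG[of k]] by simp
  have main: "real (Suc k) \<le> 4 * (Q + C * Q)" for k
  proof -
    \<comment> \<open>Since f k is a k times u k, the function l \<open>H\<^sub>1\<close> dominates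
      f k a.e.\<close>
    define l where "l = a k * (2 * 4 ^ k)"
    have l: "0 < l" using a by (simp add: l_def)
    have "AE x in \<mu>. epowr (f k x) r * W x \<le> ennreal (l powr r) * ennreal (H\<^sub>1 x * H\<^sub>2 x)"
      using u_le[of k]
    proof eventually_elim
      case (elim x)
      have "f k x \<le> ennreal (a k) * ennreal (2 * 4 ^ k * H\<^sub>1 x)"
        unfolding u(2) by (intro mult_left_mono elim) auto
      also have "\<dots> = ennreal (l * H\<^sub>1 x)"
        using a[of k] pos[of x] by (simp add: l_def mult.assoc flip: ennreal_mult)
      finally have "epowr (f k x) r * W x \<le> epowr (ennreal (l * H\<^sub>1 x)) r * W x"
        using r by (intro mult_right_mono epowr_mono) auto
      also have "\<dots> = ennreal (l powr r * (H\<^sub>1 x powr r * H\<^sub>1 x powr (1 - r)) * H\<^sub>2 x)"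
        using r l pos[of x] by (simp add: epowr_ennreal W_def powr_mult mult_ac flip: ennreal_mult)
      also have "H\<^sub>1 x powr r * H\<^sub>1 x powr (1 - r) = H\<^sub>1 x"
        using pos[of x] by (simp flip: powr_add)
      finally show ?case
        using pos[of x] by (simp add: mult.assoc flip: ennreal_mult)
    qed
    then have "(\<integral>\<^sup>+x. epowr (f k x) r * W x \<partial>\<mu>) \<le> (\<integral>\<^sup>+x. ennreal (l powr r) * ennreal (H\<^sub>1 x * H\<^sub>2 x) \<partial>\<mu>)"
      by (rule nn_integral_mono_AE)
    also have "\<dots> = ennreal (l powr r * Q)"
      using Q by (simp add: nn_integral_cmult ennreal_mult)
    finally have "ennreal C * (\<integral>\<^sup>+x. epowr (f k x) r * W x \<partial>\<mu>) \<le> ennreal C * ennreal (l powr r * Q)"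
      by (intro mult_left_mono) auto
    then have gW: "(\<integral>\<^sup>+x. epowr (g k x) r * W x \<partial>\<mu>) \<le> ennreal (C * (l powr r * Q))"
      using C_pos Q C[of k] by (simp add: ennreal_mult)
    have "ennreal (N k * a k) \<le> (\<integral>\<^sup>+x. g k x * v k x \<partial>\<mu>)"
      by (rule v)
    also have "\<dots> \<le> (\<integral>\<^sup>+x. ennreal (2 * 4 ^ k) * (ennreal l * ennreal (H\<^sub>1 x * H\<^sub>2 x)
        + ennreal (l powr (1 - r)) * (epowr (g k x) r * W x)) \<partial>\<mu>)"
    proof (rule nn_integral_mono_AE, use v_le[of k] in eventually_elim)
      fix x assume "v k x \<le> ennreal (2 * 4 ^ k * H\<^sub>2 x)"
      \<comment> \<open>Splitting at height l \<open>H\<^sub>1\<close>: after multiplication by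
        \<open>H\<^sub>2\<close> the first part is l \<open>H\<^sub>1\<close>
        \<open>H\<^sub>2\<close> and the second is l^(1-r) (g k)^r W.\<close>
      moreover have "g k x \<le> ennreal (l * H\<^sub>1 x) + ennreal ((l * H\<^sub>1 x) powr (1 - r)) * epowr (g k x) r"
        using l r pos[of x] by (intro ennreal_le_add_powr) auto
      ultimately have "g k x * v k x \<le>
          (ennreal (l * H\<^sub>1 x) + ennreal ((l * H\<^sub>1 x) powr (1 - r)) * epowr (g k x) r) * ennreal (2 * 4 ^ k * H\<^sub>2 x)"
        by (intro mult_mono) auto
      also have "\<dots> = ennreal (2 * 4 ^ k) * (ennreal l * ennreal (H\<^sub>1 x * H\<^sub>2 x)
          + ennreal (l powr (1 - r)) * (epowr (g k x) r * W x))"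
        using l pos[of x] by (simp add: W_def powr_mult ennreal_mult distrib_left mult_ac)
      finally show "g k x * v k x \<le> ennreal (2 * 4 ^ k) * (ennreal l * ennreal (H\<^sub>1 x * H\<^sub>2 x)
          + ennreal (l powr (1 - r)) * (epowr (g k x) r * W x))" .
    qed
    also have "\<dots> = ennreal (2 * 4 ^ k) * (ennreal l * ennreal Q
          + ennreal (l powr (1 - r)) * (\<integral>\<^sup>+x. epowr (g k x) r * W x \<partial>\<mu>))"
      by (simp add: nn_integral_cmult nn_integral_add Q)
    also have "\<dots> \<le> ennreal (2 * 4 ^ k) * (ennreal l * ennreal Q + ennreal (l powr (1 - r)) * ennreal (C * (l powr r * Q)))"
      by (intro mult_left_mono add_left_mono gW) auto
    also have "\<dots> = ennreal (2 * 4 ^ k * (l * Q + l powr (1 - r) * (C * (l powr r * Q))))"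
      using l Q C_pos by (simp add: ennreal_mult ennreal_plus)
    also have "l powr (1 - r) * (C * (l powr r * Q)) = (l powr (1 - r) * l powr r) * (C * Q)"
      by (simp add: mult_ac)
    also have "l powr (1 - r) * l powr r = l"
      using l by (simp flip: powr_add)
    \<comment> \<open>The bound has become linear in l, hence in a k, so the unknown scale of the
      pair drops out.\<close>
    also have "2 * 4 ^ k * (l * Q + l * (C * Q)) = a k * 16 ^ k * (4 * (Q + C * Q))"
    proof -
      have "(4::real) ^ k * 4 ^ k = 16 ^ k" by (simp flip: power_mult_distrib)
      then show ?thesis unfolding l_def by (simp add: algebra_simps)
    qed
    finally have "N k * a k \<le> a k * 16 ^ k * (4 * (Q + C * Q))"
      using Q C_pos a[of k] by (subst (asm) ennreal_le_iff) auto
    then have "a k * 16 ^ k * real (Suc k) \<le> a k * 16 ^ k * (4 * (Q + C * Q))"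
      by (simp only: N_def mult_ac)
    then show ?thesis
      by (rule mult_left_le_imp_le) (simp add: a)
  qed
  obtain k where "4 * (Q + C * Q) < real k"
    using reals_Archimedean2 by blast
  with main[of k] show False by simp
qed

end

subsection \<open>The Jacobi measure\<close>

text \<open>The concave sine lies above its chord between 0 and pi / 2.\<close>

lemma linear_le_sin_half:
  assumes "0 \<le> \<theta>" "\<theta> \<le> pi"
  shows "\<theta> / pi \<le> sin (\<theta> / 2)"
proof -
  have "convex_on {0..pi} (\<lambda>x. - sin x)"
  proof (rule f''_ge0_imp_convex)
    show "((\<lambda>x. - sin x) has_real_derivative - cos x) (at x)" for x :: real
      by (auto intro!: derivative_eq_intros)
    show "((\<lambda>x. - cos x) has_real_derivative sin x) (at x)" for x :: real
      by (auto intro!: derivative_eq_intros)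
    show "0 \<le> sin x" if "x \<in> {0..pi}" for x
      using that by (intro sin_ge_zero) auto
  qed simp
  from convex_onD[OF this, of "\<theta> / pi" 0 "pi / 2"] show ?thesis
    using assms by simp
qed

text \<open>Squares of sine and cosine add up to 1, so at least one of the two is >= 1/2 and only
  the other can make a negative power large. Hence a sum of one-sided singularities dominates the
  product; positive exponents are lowered to 0, as both functions are at most 1.\<close>

lemma jacobi_weight_bound:
  fixes \<theta> a b :: real
  assumes "0 < \<theta>" "\<theta> < pi"
  defines "a' \<equiv> min a 0" and "b' \<equiv> min b 0"
  shows "sin (\<theta> / 2) powr a * cos (\<theta> / 2) powr b
    \<le> 2 powr (- b') * pi powr (- a') * \<theta> powr a' + 2 powr (- a') * pi powr (- b') * (pi - \<theta>) powr b'"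
proof -
  let ?s = "sin (\<theta> / 2)" and ?c = "cos (\<theta> / 2)"
  have s: "\<theta> / pi \<le> ?s"
    using assms by (intro linear_le_sin_half) auto
  have "?c = sin ((pi - \<theta>) / 2)"
    by (simp add: cos_sin_eq diff_divide_distrib)
  then have c: "(pi - \<theta>) / pi \<le> ?c"
    using assms linear_le_sin_half[of "pi - \<theta>"] by simp
  have pos: "0 < ?s" "0 < ?c"
    using assms s c by (auto intro: less_le_trans[rotated] divide_pos_pos)
  have a': "a' \<le> 0" "a' \<le> a" and b': "b' \<le> 0" "b' \<le> b"
    by (auto simp: a'_def b'_def)
  have "?s powr a' \<le> (\<theta> / pi) powr a'" "?c powr b' \<le> ((pi - \<theta>) / pi) powr b'"
    using assms a' b' s c by (auto intro!: powr_mono2')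
  then have s': "?s powr a' \<le> pi powr (- a') * \<theta> powr a'" and c': "?c powr b' \<le> pi powr (- b') * (pi - \<theta>) powr b'"
    using assms by (simp_all add: powr_divide powr_minus field_simps)
  have "?s powr a \<le> ?s powr a'" "?c powr b \<le> ?c powr b'"
    using pos a' b' by (auto intro!: powr_mono')
  then have le: "?s powr a * ?c powr b \<le> ?s powr a' * ?c powr b'"
    by (intro mult_mono) auto
  show ?thesis
  proof (cases "1 / 2 \<le> ?s")
    case True
    then have "?s powr a' \<le> (1 / 2) powr a'"
      using a' by (intro powr_mono2') auto
    then have "?s powr a' * ?c powr b' \<le> 2 powr (- a') * (pi powr (- b') * (pi - \<theta>) powr b')"
      using c' by (intro mult_mono) (auto simp: powr_divide powr_minus_divide)
    with le show ?thesis
      by (simp add: mult.assoc add_increasing)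
  next
    case False
    have "1 / 2 \<le> ?c"
    proof (rule ccontr)
      assume "\<not> 1 / 2 \<le> ?c"
      then have "?s\<^sup>2 + ?c\<^sup>2 < (1 / 2)\<^sup>2 + (1 / 2)\<^sup>2"
        using False pos by (intro add_strict_mono power_strict_mono) auto
      then show False
        unfolding sin_cos_squared_add by (simp add: power2_eq_square)
    qed
    then have "?c powr b' \<le> (1 / 2) powr b'"
      using b' by (intro powr_mono2') auto
    then have "?s powr a' * ?c powr b' \<le> (pi powr (- a') * \<theta> powr a') * 2 powr (- b')"
      using s' by (intro mult_mono) (auto simp: powr_divide powr_minus_divide)
    with le show ?thesis
      by (simp add: mult_ac add_increasing2)
  qed
qed

lemma nn_integral_powr_finite:
  assumes "-1 < a"
  shows "(\<integral>\<^sup>+t. ennreal (t powr a) * indicator {0<..<pi} t \<partial>lborel) < top"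
proof -
  have "(\<integral>\<^sup>+t. ennreal (t powr a) * indicator {0<..<pi} t \<partial>lborel)
      = (\<integral>\<^sup>+t. ennreal (t powr (a + 1 - 1)) * indicator {t. 0 < t \<and> ennreal t < ennreal pi} t \<partial>lborel)"
    by (intro nn_integral_cong) (auto simp: indicator_def ennreal_less_iff)
  also have "\<dots> = epowr (ennreal pi) (a + 1) * ennreal (1 / (a + 1))"
    using assms by (intro nn_integral_powr_below) simp
  finally show ?thesis
    using assms by (simp add: epowr_ennreal ennreal_mult_less_top)
qed

lemma jacobi_density_measurable [measurable]:
  "(\<lambda>\<theta>. sin (\<theta> / 2) powr a * cos (\<theta> / 2) powr b) \<in> borel_measurable (lebesgue_on {0<..<pi})"
  by (intro measurable_restrict_space1 measurable_completion) measurable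

lemma nn_integral_jacobi_density_finite:
  assumes "-1 < a" "-1 < b"
  shows "(\<integral>\<^sup>+\<theta>. ennreal (sin (\<theta> / 2) powr a * cos (\<theta> / 2) powr b) \<partial>lebesgue_on {0<..<pi}) < top"
proof -
  let ?A = "2 powr (- min b 0) * pi powr (- min a 0)" and ?B = "2 powr (- min a 0) * pi powr (- min b 0)"
  have "(\<integral>\<^sup>+\<theta>. ennreal (sin (\<theta> / 2) powr a * cos (\<theta> / 2) powr b) \<partial>lebesgue_on {0<..<pi})
      = (\<integral>\<^sup>+\<theta>. ennreal (sin (\<theta> / 2) powr a * cos (\<theta> / 2) powr b) * indicator {0<..<pi} \<theta> \<partial>lborel)"
    by (subst nn_integral_restrict_space) (simp_all add: nn_integral_completion)
  also have "\<dots> \<le> (\<integral>\<^sup>+\<theta>. ennreal ?A * (ennreal (\<theta> powr min a 0) * indicator {0<..<pi} \<theta>)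
      + ennreal ?B * (ennreal ((pi - \<theta>) powr min b 0) * indicator {0<..<pi} \<theta>) \<partial>lborel)"
    by (intro nn_integral_mono)
       (auto simp: indicator_def intro!: ennreal_leI jacobi_weight_bound simp flip: ennreal_mult ennreal_plus)
  also have "\<dots> = ennreal ?A * (\<integral>\<^sup>+\<theta>. ennreal (\<theta> powr min a 0) * indicator {0<..<pi} \<theta> \<partial>lborel)
      + ennreal ?B * (\<integral>\<^sup>+\<theta>. ennreal ((pi - \<theta>) powr min b 0) * indicator {0<..<pi} \<theta> \<partial>lborel)"
    by (simp add: nn_integral_add nn_integral_cmult)
  also have "(\<integral>\<^sup>+\<theta>. ennreal ((pi - \<theta>) powr min b 0) * indicator {0<..<pi} \<theta> \<partial>lborel)
      = (\<integral>\<^sup>+\<theta>. ennreal (\<theta> powr min b 0) * indicator {0<..<pi} \<theta> \<partial>lborel)"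
    by (subst nn_integral_real_affine[where c="-1" and t=pi])
       (auto intro!: nn_integral_cong simp: indicator_def)
  also have "ennreal ?A * (\<integral>\<^sup>+\<theta>. ennreal (\<theta> powr min a 0) * indicator {0<..<pi} \<theta> \<partial>lborel)
      + ennreal ?B * (\<integral>\<^sup>+\<theta>. ennreal (\<theta> powr min b 0) * indicator {0<..<pi} \<theta> \<partial>lborel) < top"
    using nn_integral_powr_finite[of "min a 0"] nn_integral_powr_finite[of "min b 0"] assms
    by (simp add: ennreal_mult_less_top)
  finally show ?thesis .
qed

lemma space_jacobi [simp]: "space (jacobi_measure \<alpha> \<beta>) = {0<..<pi}"
  by (simp add: jacobi_measure_def)

lemma space_jacobi_interval: "space (jacobi_measure \<alpha> \<beta>) \<in> intervals_of (jacobi_measure \<alpha> \<beta>)"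
  unfolding intervals_of_def space_jacobi using pi_gt_zero by blast

lemma sets_jacobi: "A \<in> sets borel \<Longrightarrow> A \<subseteq> {0<..<pi} \<Longrightarrow> A \<in> sets (jacobi_measure \<alpha> \<beta>)"
  by (simp add: jacobi_measure_def sets_restrict_space_iff)

text \<open>The density is strictly positive on (0, pi), so the null sets are those of Lebesgue
  measure; in particular end points of intervals are null.\<close>

lemma AE_jacobi_iff:
  "(AE \<theta> in jacobi_measure \<alpha> \<beta>. P \<theta>) \<longleftrightarrow> (AE \<theta> in lborel. \<theta> \<in> {0<..<pi} \<longrightarrow> P \<theta>)"
proof -
  have pos: "0 < sin (\<theta> / 2) powr (2 * \<alpha> + 1) * cos (\<theta> / 2) powr (2 * \<beta> + 1)" if "\<theta> \<in> {0<..<pi}" for \<theta>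
  proof -
    have "0 < sin (\<theta> / 2)" "0 < cos (\<theta> / 2)"
      using that by (auto intro!: sin_gt_zero cos_gt_zero)
    then show ?thesis by simp
  qed
  have "(AE \<theta> in jacobi_measure \<alpha> \<beta>. P \<theta>) \<longleftrightarrow> (AE \<theta> in lebesgue_on {0<..<pi}. P \<theta>)"
    unfolding jacobi_measure_def AE_density[OF measurable_compose[OF jacobi_density_measurable measurable_ennreal]]
    using pos by (intro AE_cong) auto
  also have "\<dots> \<longleftrightarrow> (AE \<theta> in lborel. \<theta> \<in> {0<..<pi} \<longrightarrow> P \<theta>)"
    by (subst AE_restrict_space_iff) (simp_all add: AE_completion_iff)
  finally show ?thesis .
qed

lemma interval_space_jacobi:
  assumes "-1 < \<alpha>" "-1 < \<beta>"
  shows "interval_space (jacobi_measure \<alpha> \<beta>)"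
proof (intro interval_space.intro interval_space_axioms.intro finite_measureI)
  have "emeasure (jacobi_measure \<alpha> \<beta>) {0<..<pi} = (\<integral>\<^sup>+\<theta>.
      ennreal (sin (\<theta> / 2) powr (2 * \<alpha> + 1) * cos (\<theta> / 2) powr (2 * \<beta> + 1)) \<partial>lebesgue_on {0<..<pi})"
    unfolding jacobi_measure_def
    by (subst emeasure_density) (auto intro!: nn_integral_cong simp: sets_restrict_space_iff)
  also have "\<dots> < top"
    using assms by (intro nn_integral_jacobi_density_finite) auto
  finally have "emeasure (jacobi_measure \<alpha> \<beta>) {0<..<pi} < top" .
  then show "emeasure (jacobi_measure \<alpha> \<beta>) (space (jacobi_measure \<alpha> \<beta>)) \<noteq> \<infinity>"
    by simp
  show sets: "intervals_of (jacobi_measure \<alpha> \<beta>) \<subseteq> sets (jacobi_measure \<alpha> \<beta>)"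
    by (auto simp: intervals_of_def intro!: sets_jacobi)
  fix I assume I: "I \<in> intervals_of (jacobi_measure \<alpha> \<beta>)"
  then obtain a b where ab: "a < b" "I = {a<..<b}" "I \<subseteq> {0<..<pi}"
    by (auto simp: intervals_of_def)
  show "emeasure (jacobi_measure \<alpha> \<beta>) I \<noteq> 0"
  proof
    assume "emeasure (jacobi_measure \<alpha> \<beta>) I = 0"
    then have "AE \<theta> in jacobi_measure \<alpha> \<beta>. \<theta> \<notin> I"
      using I sets by (intro AE_not_in) (auto simp: null_sets_def)
    then have "AE \<theta> in lborel. \<theta> \<notin> I"
      unfolding AE_jacobi_iff by eventually_elim (use ab in auto)
    then have "emeasure lborel I = 0"
      using ab(2) AE_iff_null_sets[of I lborel] by (simp add: null_sets_def)
    then show False using ab by simp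
  qed
qed

section \<open>Passage between the two forms of the A_p condition\<close>

lemma L1_loc_AE_finite:
  assumes "u \<in> L1_loc \<alpha> \<beta>"
  shows "AE \<theta> in jacobi_measure \<alpha> \<beta>. u \<theta> \<noteq> top"
proof -
  have [measurable]: "u \<in> borel_measurable (jacobi_measure \<alpha> \<beta>)"
    using assms by (simp add: L1_loc_def)
  define K where "K n = {1 / real (Suc n) .. pi - 1 / real (Suc n)}" for n
  have "AE \<theta> in jacobi_measure \<alpha> \<beta>. \<theta> \<in> K n \<longrightarrow> u \<theta> \<noteq> top" for n
  proof -
    have sub: "K n \<subseteq> {0<..<pi}"
    proof
      fix x assume "x \<in> K n"
      moreover have "0 < 1 / real (Suc n)" by simp
      ultimately show "x \<in> {0<..<pi}"
        unfolding K_def atLeastAtMost_iff greaterThanLessThan_iff by linarith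
    qed
    then have "(\<integral>\<^sup>+\<theta>\<in>K n. u \<theta> \<partial>jacobi_measure \<alpha> \<beta>) \<noteq> \<infinity>"
      using assms by (auto simp: L1_loc_def K_def)
    moreover have [measurable]: "K n \<in> sets (jacobi_measure \<alpha> \<beta>)"
      using sub by (intro sets_jacobi) (auto simp: K_def)
    ultimately have "AE \<theta> in jacobi_measure \<alpha> \<beta>. u \<theta> * indicator (K n) \<theta> \<noteq> \<infinity>"
      by (intro nn_integral_PInf_AE) auto
    then show ?thesis
      by eventually_elim (auto simp: indicator_def)
  qed
  then have "AE \<theta> in jacobi_measure \<alpha> \<beta>. \<forall>n. \<theta> \<in> K n \<longrightarrow> u \<theta> \<noteq> top"
    unfolding AE_all_countable by blast
  then show ?thesis
    using AE_space
  proof eventually_elim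
    case (elim \<theta>)
    then have "0 < min \<theta> (pi - \<theta>)" by auto
    then obtain n where "1 / real (Suc n) < min \<theta> (pi - \<theta>)"
      using nat_approx_posE by blast
    then have "\<theta> \<in> K n" by (auto simp: K_def)
    with elim show ?case by blast
  qed
qed

text \<open>The end points are infimum and supremum, distinct because the interior is nonempty. This
  reduces the arbitrary intervals of \<open>A_weights\<close> to the open ones of
  \<open>Ap\<close>.\<close>

lemma interval_inner_open:
  fixes J :: "real set"
  assumes J: "is_interval J" "J \<subseteq> {0<..<pi}" "interior J \<noteq> {}"
  obtains a b where "a < b" "{a<..<b} \<subseteq> J" "J \<subseteq> {a..b}"
proof -
  have ne: "J \<noteq> {}" using J(3) interior_subset by blast
  have bdd: "bdd_below J" "bdd_above J"
    using J(2) by (auto intro!: bdd_belowI[of J 0] bdd_aboveI[of J pi] less_imp_le)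
  have sub: "J \<subseteq> {Inf J..Sup J}"
    using bdd by (auto intro: cInf_lower cSup_upper)
  have "{Inf J<..<Sup J} \<subseteq> J"
  proof
    fix x assume x: "x \<in> {Inf J<..<Sup J}"
    then obtain y z where "y \<in> J" "y < x" "z \<in> J" "x < z"
      using cInf_less_iff[OF ne bdd(1), of x] less_cSup_iff[OF ne bdd(2), of x] by auto
    then show "x \<in> J"
      using J(1) unfolding is_interval_1 by (meson less_imp_le)
  qed
  moreover have "Inf J < Sup J"
  proof (rule ccontr)
    assume "\<not> Inf J < Sup J"
    then have "J \<subseteq> {Inf J}" using sub by auto
    then have "interior J \<subseteq> interior {Inf J}" by (rule interior_mono)
    then show False using J(3) by simp
  qed
  ultimately show ?thesis using sub that by blast
qed

lemma conj_exp_simps: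
  assumes "1 < p"
  shows "- conj_exp p / p = - 1 / (p - 1)" "p / conj_exp p = p - 1"
  using assms by (simp_all add: conj_exp_def field_simps)

lemma open_interval_eq:
  assumes "a < b" "{a<..<b} \<subseteq> J" "J \<subseteq> {a..b}"
  shows "AE \<theta> in jacobi_measure \<alpha> \<beta>. \<theta> \<in> J \<longleftrightarrow> \<theta> \<in> {a<..<b}"
  unfolding AE_jacobi_iff using AE_lborel_singleton[of a] AE_lborel_singleton[of b]
  by eventually_elim (use assms in force)

text \<open>The two averages contribute 1 and p - 1 powers of 1 / m; this identity clears the
  denominators in the A_p condition.\<close>

lemma average_product:
  fixes V S :: ennreal
  assumes "0 < m" and "1 < p"
  shows "V / ennreal m * epowr (S / ennreal m) (p - 1) = V * epowr S (p - 1) / ennreal (m powr p)"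
proof -
  have div: "x / ennreal m = x * ennreal (1 / m)" for x
    using assms by (simp add: divide_ennreal_def inverse_ennreal inverse_eq_divide)
  have "1 / m * (1 / m) powr (p - 1) = 1 / m powr p"
    using assms powr_add[of "1 / m" 1 "p - 1"] by (simp add: powr_divide)
  then have "ennreal (1 / m) * ennreal ((1 / m) powr (p - 1)) = ennreal (1 / m powr p)"
    using assms by (subst ennreal_mult[symmetric]) auto
  moreover have "ennreal (1 / m powr p) = inverse (ennreal (m powr p))"
    using assms by (simp add: inverse_ennreal inverse_eq_divide)
  ultimately show ?thesis
    using assms unfolding div divide_ennreal_def[of _ "ennreal (m powr p)"]
    by (simp add: epowr_mult epowr_ennreal mult_ac)
qed

context
  fixes \<alpha> \<beta> :: real
  assumes \<alpha>: "-1 < \<alpha>" and \<beta>: "-1 < \<beta>"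
begin

interpretation interval_space "jacobi_measure \<alpha> \<beta>"
  using \<alpha> \<beta> by (rule interval_space_jacobi)

lemma A_weights_imp_Ap:
  assumes p: "1 < p" and w: "w \<in> A_weights \<alpha> \<beta> p"
  obtains v where "Ap p v" "AE \<theta> in jacobi_measure \<alpha> \<beta>. w \<theta> = ennreal (v \<theta>)"
proof -
  let ?\<mu> = "jacobi_measure \<alpha> \<beta>"
  let ?s = "\<lambda>\<theta>. epowr (w \<theta>) (- 1 / (p - 1))"
  have L1: "w \<in> L1_loc \<alpha> \<beta>" "?s \<in> L1_loc \<alpha> \<beta>"
    and SUP: "(SUP I \<in> {I. is_interval I \<and> I \<subseteq> {0<..<pi} \<and> interior I \<noteq> {}}.
      average \<alpha> \<beta> I w * epowr (average \<alpha> \<beta> I ?s) (p - 1)) < top" (is "?sup < top")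
    using w unfolding A_weights_def conj_exp_simps[OF p] infinity_ennreal_def by blast+
  have [measurable]: "w \<in> borel_measurable ?\<mu>"
    using L1 by (simp add: L1_loc_def)
  \<comment> \<open>The exceptional set is null: local integrability of w excludes the value
    infinity, and that of its negative power, which is infinite where w = 0, excludes 0.\<close>
  define v where "v \<theta> = (if w \<theta> = 0 \<or> w \<theta> = top then 1 else enn2real (w \<theta>))" for \<theta>
  have [measurable]: "v \<in> borel_measurable ?\<mu>"
    unfolding v_def by measurable
  have vpos: "0 < v \<theta>" for \<theta>
    by (auto simp: v_def enn2real_positive_iff less_top zero_less_iff_neq_zero)
  have dpos: "0 < dual_weight p v \<theta>" for \<theta>
    by (rule dual_weight_pos) (rule vpos)
  have wv: "AE \<theta> in ?\<mu>. w \<theta> = ennreal (v \<theta>)"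
    using L1_loc_AE_finite[OF L1(1)] L1_loc_AE_finite[OF L1(2)]
    by eventually_elim (use p in \<open>auto simp: v_def epowr_def less_top\<close>)
  then have sv: "AE \<theta> in ?\<mu>. ?s \<theta> = ennreal (dual_weight p v \<theta>)"
    by eventually_elim (simp add: epowr_ennreal vpos dual_weight_def)
  obtain K where K: "0 \<le> K" "?sup = ennreal K"
    using enn2real_nonneg ennreal_enn2real[OF SUP, symmetric] by (rule that)
  have bound: "(\<integral>\<^sup>+\<theta>\<in>I. v \<theta> \<partial>?\<mu>) * epowr (\<integral>\<^sup>+\<theta>\<in>I. dual_weight p v \<theta> \<partial>?\<mu>) (p - 1)
      \<le> ennreal (K + 1) * epowr (emeasure ?\<mu> I) p" if I: "I \<in> intervals_of ?\<mu>" for I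
  proof -
    obtain m where m: "0 < m" "emeasure ?\<mu> I = ennreal m"
      using interval_measure[OF I] by auto
    have "(\<integral>\<^sup>+\<theta>\<in>I. w \<theta> \<partial>?\<mu>) = (\<integral>\<^sup>+\<theta>\<in>I. v \<theta> \<partial>?\<mu>)"
      using wv by (intro nn_integral_cong_AE) auto
    moreover have "(\<integral>\<^sup>+\<theta>\<in>I. ?s \<theta> \<partial>?\<mu>) = (\<integral>\<^sup>+\<theta>\<in>I. dual_weight p v \<theta> \<partial>?\<mu>)"
      using sv by (intro nn_integral_cong_AE) auto
    moreover have "average \<alpha> \<beta> I w * epowr (average \<alpha> \<beta> I ?s) (p - 1) \<le> ennreal K"
      unfolding K(2)[symmetric]
      using I by (intro SUP_upper) (auto simp: intervals_of_def is_interval_1 interior_open)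
    ultimately have le: "(\<integral>\<^sup>+\<theta>\<in>I. v \<theta> \<partial>?\<mu>) * epowr (\<integral>\<^sup>+\<theta>\<in>I. dual_weight p v \<theta> \<partial>?\<mu>) (p - 1) / ennreal (m powr p) \<le> ennreal K"
      using average_product[OF m(1) p] by (simp add: average_def m)
    have "(\<integral>\<^sup>+\<theta>\<in>I. v \<theta> \<partial>?\<mu>) * epowr (\<integral>\<^sup>+\<theta>\<in>I. dual_weight p v \<theta> \<partial>?\<mu>) (p - 1)
        = ennreal (m powr p) * ((\<integral>\<^sup>+\<theta>\<in>I. v \<theta> \<partial>?\<mu>) * epowr (\<integral>\<^sup>+\<theta>\<in>I. dual_weight p v \<theta> \<partial>?\<mu>) (p - 1) / ennreal (m powr p))"
      using m by (intro ennreal_mult_divide_cancel[symmetric]) simp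
    also have "\<dots> \<le> ennreal (m powr p) * ennreal (K + 1)"
      by (intro mult_left_mono order_trans[OF le]) (auto intro: ennreal_leI)
    also have "\<dots> = ennreal (K + 1) * epowr (emeasure ?\<mu> I) p"
      using m p by (simp add: epowr_ennreal mult.commute)
    finally show ?thesis .
  qed
  \<comment> \<open>Local integrability says nothing near 0 and pi. The A_p bound on (0, pi) itself
    makes the product of the two full integrals finite, and as neither is 0, both are
    finite.\<close>
  have space: "{0<..<pi} \<in> intervals_of ?\<mu>"
    using space_jacobi_interval[of \<alpha> \<beta>] by simp
  have whole: "(\<integral>\<^sup>+\<theta>\<in>{0<..<pi}. k \<theta> \<partial>?\<mu>) = (\<integral>\<^sup>+\<theta>. k \<theta> \<partial>?\<mu>)" for k
    by (intro nn_integral_cong) simp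
  have "(\<integral>\<^sup>+\<theta>. v \<theta> \<partial>?\<mu>) * epowr (\<integral>\<^sup>+\<theta>. dual_weight p v \<theta> \<partial>?\<mu>) (p - 1) < top"
  proof -
    obtain m where "0 < m" "emeasure ?\<mu> {0<..<pi} = ennreal m"
      using interval_measure[OF space] by blast
    then have "ennreal (K + 1) * epowr (emeasure ?\<mu> {0<..<pi}) p < top"
      by (simp add: epowr_ennreal ennreal_mult_less_top)
    then show ?thesis
      using le_less_trans[OF bound[OF space]] unfolding whole by blast
  qed
  moreover have "(\<integral>\<^sup>+\<theta>. v \<theta> \<partial>?\<mu>) \<noteq> 0" "(\<integral>\<^sup>+\<theta>. dual_weight p v \<theta> \<partial>?\<mu>) \<noteq> 0"
    using interval_integral_nonzero[OF space, of v] interval_integral_nonzero[OF space, of "dual_weight p v"]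
      vpos dpos unfolding whole by auto
  ultimately have "(\<integral>\<^sup>+\<theta>. v \<theta> \<partial>?\<mu>) < top" "(\<integral>\<^sup>+\<theta>. dual_weight p v \<theta> \<partial>?\<mu>) < top"
    using p by (auto simp: ennreal_mult_less_top less_top[symmetric])
  then have "Ap p v"
    unfolding Ap_def using vpos bound K(1) by (auto intro!: exI[of _ "K + 1"])
  then show ?thesis using wv that by blast
qed

lemma Ap_imp_A_weights:
  assumes r: "1 < r" and W: "Ap r W"
  shows "(\<lambda>\<theta>. ennreal (W \<theta>)) \<in> A_weights \<alpha> \<beta> r"
proof -
  let ?\<mu> = "jacobi_measure \<alpha> \<beta>"
  have [measurable]: "W \<in> borel_measurable ?\<mu>" and pos: "\<And>\<theta>. 0 < W \<theta>"
    and fin: "(\<integral>\<^sup>+\<theta>. W \<theta> \<partial>?\<mu>) < top" "(\<integral>\<^sup>+\<theta>. dual_weight r W \<theta> \<partial>?\<mu>) < top"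
    using W by (auto simp: Ap_def)
  obtain K :: real where K: "0 < K" "\<And>I. I \<in> intervals_of ?\<mu> \<Longrightarrow>
      (\<integral>\<^sup>+\<theta>\<in>I. W \<theta> \<partial>?\<mu>) * epowr (\<integral>\<^sup>+\<theta>\<in>I. dual_weight r W \<theta> \<partial>?\<mu>) (r - 1) \<le> K * epowr (emeasure ?\<mu> I) r"
    using W by (auto simp: Ap_def)
  have dual: "(\<lambda>\<theta>. epowr (ennreal (W \<theta>)) (- 1 / (r - 1))) = (\<lambda>\<theta>. ennreal (dual_weight r W \<theta>))"
    by (simp add: epowr_ennreal pos dual_weight_def)
  have L1: "(\<lambda>\<theta>. ennreal (k \<theta>)) \<in> L1_loc \<alpha> \<beta>"
    if [measurable]: "k \<in> borel_measurable ?\<mu>" and fin: "(\<integral>\<^sup>+\<theta>. ennreal (k \<theta>) \<partial>?\<mu>) < top" for k :: "real \<Rightarrow> real"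
  proof -
    have "(\<integral>\<^sup>+\<theta>\<in>K. ennreal (k \<theta>) \<partial>?\<mu>) < top" for K
      by (rule le_less_trans[OF _ fin]) (auto intro!: nn_integral_mono simp: indicator_def)
    then show ?thesis by (simp add: L1_loc_def)
  qed
  have bound: "average \<alpha> \<beta> J (\<lambda>\<theta>. ennreal (W \<theta>)) * epowr (average \<alpha> \<beta> J (\<lambda>\<theta>. ennreal (dual_weight r W \<theta>))) (r - 1) \<le> ennreal K"
    if J: "is_interval J" "J \<subseteq> {0<..<pi}" "interior J \<noteq> {}" for J
  proof -
    obtain a b where ab: "a < b" "{a<..<b} \<subseteq> J" "J \<subseteq> {a..b}"
      using interval_inner_open[OF J] by blast
    let ?I = "{a<..<b}"
    have I: "?I \<in> intervals_of ?\<mu>"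
      using ab J by (auto simp: intervals_of_def)
    have "J \<in> sets ?\<mu>"
    proof (rule sets_jacobi[OF _ J(2)])
      \<comment> \<open>J differs from an open interval by at most its two end points, hence is a
        Borel set with the same measure.\<close>
      have "J = {a<..<b} \<union> (J \<inter> {a, b})"
        using ab by force
      moreover have "{a<..<b} \<union> (J \<inter> {a, b}) \<in> sets borel"
        by (intro sets.Un) (auto intro: borel_closed finite_imp_closed)
      ultimately show "J \<in> sets borel" by simp
    qed
    moreover have "?I \<in> sets ?\<mu>"
      using I sets by auto
    ultimately have em: "emeasure ?\<mu> J = emeasure ?\<mu> ?I"
      using open_interval_eq[OF ab] by (intro emeasure_eq_AE) auto
    have avg: "average \<alpha> \<beta> J k = (\<integral>\<^sup>+\<theta>\<in>?I. k \<theta> \<partial>?\<mu>) / emeasure ?\<mu> ?I" for k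
    proof -
      have "(\<integral>\<^sup>+\<theta>\<in>J. k \<theta> \<partial>?\<mu>) = (\<integral>\<^sup>+\<theta>\<in>?I. k \<theta> \<partial>?\<mu>)"
        using open_interval_eq[OF ab, of \<alpha> \<beta>] by (intro nn_integral_cong_AE) (auto simp: indicator_def elim!: eventually_mono)
      then show ?thesis by (simp add: average_def em)
    qed
    obtain m where m: "0 < m" "emeasure ?\<mu> ?I = ennreal m"
      using interval_measure[OF I] by auto
    have "(\<integral>\<^sup>+\<theta>\<in>?I. W \<theta> \<partial>?\<mu>) * epowr (\<integral>\<^sup>+\<theta>\<in>?I. dual_weight r W \<theta> \<partial>?\<mu>) (r - 1) / ennreal (m powr r)
        \<le> ennreal (m powr r) * ennreal K / ennreal (m powr r)"
      using K(2)[OF I] m r by (intro divide_right_mono_ennreal) (simp add: epowr_ennreal mult.commute)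
    also have "\<dots> = ennreal K"
      using m by (simp add: mult.commute[of "ennreal (m powr r)"] ennreal_mult_divide_eq)
    finally show ?thesis
      using average_product[OF m(1) r] by (simp add: avg m)
  qed
  have "(SUP I \<in> {I. is_interval I \<and> I \<subseteq> {0<..<pi} \<and> interior I \<noteq> {}}.
      average \<alpha> \<beta> I (\<lambda>\<theta>. ennreal (W \<theta>)) * epowr (average \<alpha> \<beta> I (\<lambda>\<theta>. ennreal (dual_weight r W \<theta>))) (r - 1)) \<le> ennreal K"
    by (rule SUP_least) (use bound in auto)
  note sup_fin = le_less_trans[OF this ennreal_less_top]
  show ?thesis
    unfolding A_weights_def mem_Collect_eq conj_exp_simps[OF r] infinity_ennreal_def dual
    by (intro conjI L1 sup_fin fin) measurable
qed

text \<open>Both sides of the bound depend on the weight only up to null sets, so the positive real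
  representative can replace w.\<close>

lemma jacobi_extrapolation:
  assumes r: "1 < r" and p: "1 < p" and w: "w \<in> A_weights \<alpha> \<beta> p"
    and meas: "\<And>f g. (f, g) \<in> F \<Longrightarrow>
           f \<in> borel_measurable (jacobi_measure \<alpha> \<beta>) \<and> g \<in> borel_measurable (jacobi_measure \<alpha> \<beta>)"
    and hyp: "\<And>w. w \<in> A_weights \<alpha> \<beta> r \<Longrightarrow> weighted_bound \<alpha> \<beta> F r w"
  shows "weighted_bound \<alpha> \<beta> F p w"
proof -
  let ?\<mu> = "jacobi_measure \<alpha> \<beta>"
  obtain v where v: "Ap p v" "AE \<theta> in ?\<mu>. w \<theta> = ennreal (v \<theta>)"
    using A_weights_imp_Ap[OF p w] by blast
  have "weighted_bound \<alpha> \<beta> F p (\<lambda>\<theta>. ennreal (v \<theta>))"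
    unfolding weighted_bound_def
    by (rule extrapolation[OF r p v(1) space_jacobi_interval meas])
       (use hyp[OF Ap_imp_A_weights[OF r]] in \<open>simp_all add: weighted_bound_def\<close>)
  moreover have "(\<integral>\<^sup>+\<theta>. epowr (h \<theta>) p * w \<theta> \<partial>?\<mu>) = (\<integral>\<^sup>+\<theta>. epowr (h \<theta>) p * ennreal (v \<theta>) \<partial>?\<mu>)" for h
    using v(2) by (intro nn_integral_cong_AE) auto
  ultimately show ?thesis
    by (simp add: weighted_bound_def)
qed

end

theorem theorem3p1:
  fixes \<alpha> \<beta> r :: real
    and F :: "((real \<Rightarrow> ennreal) \<times> (real \<Rightarrow> ennreal)) set"
  assumes "\<alpha> > -1" and "\<beta> > -1" and "1 < r"
    and "\<And>f g. (f, g) \<in> F \<Longrightarrow>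
           f \<in> borel_measurable (jacobi_measure \<alpha> \<beta>) \<and> g \<in> borel_measurable (jacobi_measure \<alpha> \<beta>)"
    and "\<And>w. w \<in> A_weights \<alpha> \<beta> r \<Longrightarrow> weighted_bound \<alpha> \<beta> F r w"
  shows "\<forall>p w. 1 < p \<longrightarrow> w \<in> A_weights \<alpha> \<beta> p \<longrightarrow> weighted_bound \<alpha> \<beta> F p w"
  using jacobi_extrapolation[OF assms(1-3) _ _ assms(4,5)] by blast

end
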